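(* Let $k$ be a field and let $A$ be a symmetric $k$-algebra with bilinear form $\langle-,-\rangle$. Then the BV-algebras $(HH^\bullet(A),\cup,[\ ,\ ],\Delta)$ and $(H^\bullet(A,A^* ),\cup_*,[\ ,\ ]_*,\bar B)$ are isomorphic.
   Context: Conventions. $\otimes=\otimes_k$; algebras are associative and unital. The $A$-bimodule structure on $A^*=\mathrm{Hom}_k(A,k)$ is $(afb)(x)=f(bxa)$. For an $A$-bimodule $M$, $H^\bullet(A,M)$ is Hochschild cohomology, computed by the standard complex $C^n(A,M)=\mathrm{Hom}_k(A^{\otimes n},M)$; $HH^\bullet(A)=H^\bullet(A,A)$. A symmetric algebra is a finite-dimensional $k$-algebra $A$ with a symmetric, associative ($\langle ab,c\rangle=\langle a,bc\rangle$), non-degenerate bilinear form $\langle-,-\rangle:A\times A\to k$. The map $Z:A\to A^*$, $Z(a)=\langle a,-\rangle$, is an isomorphism of $A$-bimodules. Cup products and brackets. If $M$ is an $A$-bimodule with an associative $k$-algebra structure, $(f\cup g)(a_1\otimes\cdots\otimes a_{n+m})=f(a_1\otimes\cdots\otimes a_n)g(a_{n+1}\otimes\cdots\otimes a_{n+m})$ for $f\in C^n(A,M)$, $g\in C^m(A,M)$. For $f\in C^n(A,M)$, $h\in C^m(A,A)$, $$(f\,\bar\circ\,h)(a_1\otimes\cdots\otimes a_{n+m-1})=\sum_{i=1}^n(-1)^{(i-1)(m-1)}f(a_1\otimes\cdots\otimes a_{i-1}\otimes h(a_i\otimes\cdots\otimes a_{i+m-1})\otimes a_{i+m}\otimes\cdots\otimes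 a_{n+m-1}).$$ BV-structure on $HH^\bullet(A)$ (known, due to Tradler): $\cup$ is the cup product for $M=A$; $[f,g]=f\,\bar\circ\,g-(-1)^{(n-1)(m-1)}g\,\bar\circ\,f$; and $\Delta:HH^n(A)\to HH^{n-1}(A)$ is defined by $$\langle\Delta f(a_1\otimes\cdots\otimes a_{n-1}),a_n\rangle=\sum_{i=1}^n(-1)^{i(n-1)}\langle f(a_i\otimes\cdots\otimes a_n\otimes a_1\otimes\cdots\otimes a_{i-1}),1\rangle.$$ BV-structure on $H^\bullet(A,A^* )$: $A^*$ carries the associative multiplication $f\cdot g=Z(Z^{-1}(f)Z^{-1}(g))$; $\cup_*$ is the corresponding cup product on $H^\bullet(A,A^* )$; $[f,g]_*=f\,\bar\circ\,(Z^{-1}\circ g)-(-1)^{(n-1)(m-1)}g\,\bar\circ\,(Z^{-1}\circ f)$ for $f,g$ of degrees $n,m$; and $\bar B:H^{n+1}(A,A^* )\to H^n(A,A^* )$ is $$\bar B([f])(a_1\otimes\cdots\otimes a_n)(a_0)=\sum_{i=0}^n(-1)^{ni}f(a_i\otimes\cdots\otimes a_n\otimes a_0\otimes\cdots\otimes a_{i-1})(1).$$ A Gerstenhaber algebra is $(\mathcal H^\bullet,\cup,[\ ,\ ])$ with $\mathcal H^\bullet$ a graded $k$-module, $\cup$ a graded commutative associative product of degree $0$, and $[\ ,\ ]:\mathcal H^n\times\mathcal H^m\to\mathcal H^{n+m-1}$ a graded Lie bracket with $[f,g]=-(-1)^{(|f|-1)(|g|-1)}[g,f]$, $[f,[g,h]]=[[f,g],h]+(-1)^{(|f|-1)(|g|-1)}[g,[f,h]]$,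 $[f,g\cup h]=[f,g]\cup h+(-1)^{(|f|-1)|g|}g\cup[f,h]$. A BV-algebra is a Gerstenhaber algebra with a morphism $\Delta:\mathcal H^{\bullet+1}\to\mathcal H^\bullet$ with $\Delta^2=0$ and $[f,g]=(-1)^{|f|}(\Delta(f\cup g)-\Delta(f)\cup g-(-1)^{|f|}f\cup\Delta(g))$. An isomorphism of BV-algebras is a graded $k$-linear isomorphism compatible with the products, the brackets and the BV-operators. *)

theory Defs
  imports Complex_Main "HOL-Library.Function_Algebras"
begin

section \<open>Symmetric algebras\<close>

text \<open>
  The sort \<open>{ring, monoid_mult}\<close> is used instead of \<open>ring_1\<close> because the latter excludes the zero
  algebra.
\<close>

locale k_algebra = vector_space scale
  for scale :: "'k::field \<Rightarrow> 'a::{ring,monoid_mult} \<Rightarrow> 'a" +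
  assumes scale_mult_left: "scale c a * b = scale c (a * b)"
    and scale_mult_right: "a * scale c b = scale c (a * b)"

locale symmetric_algebra = k_algebra scale
  for scale :: "'k::field \<Rightarrow> 'a::{ring,monoid_mult} \<Rightarrow> 'a" +
  fixes form :: "'a \<Rightarrow> 'a \<Rightarrow> 'k"
  assumes finite_dimensional: "\<exists>B. finite B \<and> span B = UNIV"
    and form_linear_left: "Vector_Spaces.linear scale (*) (\<lambda>a. form a b)"
    and form_linear_right: "Vector_Spaces.linear scale (*) (\<lambda>b. form a b)"
    and form_symmetric: "form a b = form b a"
    and form_associative: "form (a * b) c = form a (b * c)"
    and form_nondegenerate: "(\<And>b. form a b = 0) \<Longrightarrow> a = 0"

section \<open>Bimodules and the Hochschild complex\<close>

record ('k, 'a, 'm) bimodule =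
  mcarrier :: "'m set"
  mscale :: "'k \<Rightarrow> 'm \<Rightarrow> 'm"
  lact :: "'a \<Rightarrow> 'm \<Rightarrow> 'm"
  ract :: "'m \<Rightarrow> 'a \<Rightarrow> 'm"

definition regular_bimodule ::
    "('k::field \<Rightarrow> 'a::{ring,monoid_mult} \<Rightarrow> 'a) \<Rightarrow> ('k, 'a, 'a) bimodule" where
  "regular_bimodule scale =
    \<lparr>mcarrier = UNIV, mscale = scale, lact = (*), ract = (*)\<rparr>"

definition dual_bimodule ::
    "('k::field \<Rightarrow> 'a::{ring,monoid_mult} \<Rightarrow> 'a) \<Rightarrow> ('k, 'a, 'a \<Rightarrow> 'k) bimodule" where
  "dual_bimodule scale =
    \<lparr>mcarrier = {\<phi>. Vector_Spaces.linear scale (*) \<phi>},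
     mscale = (\<lambda>c \<phi> x. c * \<phi> x),
     lact = (\<lambda>a \<phi> x. \<phi> (x * a)),
     ract = (\<lambda>\<phi> b x. \<phi> (b * x))\<rparr>"

text \<open>
  A linear map \<open>A\<^sup>\<otimes>\<^sup>n \<rightarrow> M\<close> is encoded as the corresponding multilinear map on lists of length \<open>n\<close>,
  extended by \<open>0\<close> to lists of any other length so that equality of cochains is equality of functions.
  Addition of cochains, and of functionals in \<open>A\<^sup>*\<close>, is pointwise.
\<close>

definition cochains ::
    "('k::field \<Rightarrow> 'a::{ring,monoid_mult} \<Rightarrow> 'a) \<Rightarrow> ('k, 'a, 'm::ab_group_add) bimodule
      \<Rightarrow> nat \<Rightarrow> ('a list \<Rightarrow> 'm) set" where
  "cochains scale M n =
    {f. (\<forall>xs. length xs \<noteq> n \<longrightarrow> f xs = 0) \<and>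
        (\<forall>xs. length xs = n \<longrightarrow> f xs \<in> mcarrier M) \<and>
        (\<forall>xs i. length xs = n \<longrightarrow> i < n \<longrightarrow>
           Vector_Spaces.linear scale (mscale M) (\<lambda>a. f (xs[i := a])))}"

definition hochschild_diff ::
    "('k::field, 'a::{ring,monoid_mult}, 'm::ab_group_add) bimodule
      \<Rightarrow> nat \<Rightarrow> ('a list \<Rightarrow> 'm) \<Rightarrow> 'a list \<Rightarrow> 'm" where
  "hochschild_diff M n f xs =
    (if length xs = Suc n then
       lact M (hd xs) (f (tl xs))
       + (\<Sum>i=1..n. mscale M ((-1) ^ i)
            (f (take (i - 1) xs @ [xs ! (i - 1) * xs ! i] @ drop (i + 1) xs)))
       + mscale M ((-1) ^ (n + 1)) (ract M (f (butlast xs)) (last xs))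
     else 0)"

definition cocycles ::
    "('k::field \<Rightarrow> 'a::{ring,monoid_mult} \<Rightarrow> 'a) \<Rightarrow> ('k, 'a, 'm::ab_group_add) bimodule
      \<Rightarrow> nat \<Rightarrow> ('a list \<Rightarrow> 'm) set" where
  "cocycles scale M n = {f \<in> cochains scale M n. hochschild_diff M n f = 0}"

definition coboundaries ::
    "('k::field \<Rightarrow> 'a::{ring,monoid_mult} \<Rightarrow> 'a) \<Rightarrow> ('k, 'a, 'm::ab_group_add) bimodule
      \<Rightarrow> nat \<Rightarrow> ('a list \<Rightarrow> 'm) set" where
  "coboundaries scale M n =
    (case n of 0 \<Rightarrow> {0} | Suc m \<Rightarrow> hochschild_diff M m ` cochains scale M m)"

definition cohomologous ::
    "('k::field \<Rightarrow> 'a::{ring,monoid_mult} \<Rightarrow> 'a) \<Rightarrow> ('k, 'a, 'm::ab_group_add) bimodule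
      \<Rightarrow> nat \<Rightarrow> ('a list \<Rightarrow> 'm) rel" where
  "cohomologous scale M n =
    {(f, g). f \<in> cocycles scale M n \<and> g \<in> cocycles scale M n \<and> f - g \<in> coboundaries scale M n}"

definition hochschild_cohomology ::
    "('k::field \<Rightarrow> 'a::{ring,monoid_mult} \<Rightarrow> 'a) \<Rightarrow> ('k, 'a, 'm::ab_group_add) bimodule
      \<Rightarrow> nat \<Rightarrow> ('a list \<Rightarrow> 'm) set set" where
  "hochschild_cohomology scale M n = cocycles scale M n // cohomologous scale M n"

text \<open>
  Operations induced on classes.  The union over all representatives is a single class exactly when
  the operation on cochains descends to cohomology.
\<close>

definition induced1 :: "'y rel \<Rightarrow> ('x \<Rightarrow> 'y) \<Rightarrow> 'x set \<Rightarrow> 'y set" where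
  "induced1 R op X = (\<Union>f\<in>X. R `` {op f})"

definition induced2 ::
    "'z rel \<Rightarrow> ('x \<Rightarrow> 'y \<Rightarrow> 'z) \<Rightarrow> 'x set \<Rightarrow> 'y set \<Rightarrow> 'z set" where
  "induced2 R op X Y = (\<Union>f\<in>X. \<Union>g\<in>Y. R `` {op f g})"

section \<open>Operations on cochains\<close>

definition cup ::
    "('m \<Rightarrow> 'm \<Rightarrow> 'm) \<Rightarrow> nat \<Rightarrow> nat
      \<Rightarrow> ('a list \<Rightarrow> 'm) \<Rightarrow> ('a list \<Rightarrow> 'm::ab_group_add) \<Rightarrow> 'a list \<Rightarrow> 'm" where
  "cup mul n m f g xs =
    (if length xs = n + m then mul (f (take n xs)) (g (drop n xs)) else 0)"

text \<open>
  Here and below the sign exponents \<open>m - 1\<close> and \<open>n - 1\<close> are written \<open>m + 1\<close> and \<open>n + 1\<close>: the parity is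
  the same, and no truncated subtraction occurs in degree \<open>0\<close>.  The index \<open>i\<close> runs from \<open>0\<close> instead
  of \<open>1\<close>.  In bidegree \<open>(0, 0)\<close> the result has degree \<open>-1\<close>, i.e. it is \<open>0\<close>.
\<close>

definition circ ::
    "('k::field, 'a, 'm::ab_group_add) bimodule \<Rightarrow> nat \<Rightarrow> nat
      \<Rightarrow> ('a list \<Rightarrow> 'm) \<Rightarrow> ('a list \<Rightarrow> 'a) \<Rightarrow> 'a list \<Rightarrow> 'm" where
  "circ M n m f h xs =
    (if length xs + 1 = n + m then
       (\<Sum>i<n. mscale M ((-1) ^ (i * (m + 1)))
          (f (take i xs @ [h (take m (drop i xs))] @ drop (i + m) xs)))
     else 0)"

definition gerstenhaber_bracket ::
    "('k::field \<Rightarrow> 'a::{ring,monoid_mult} \<Rightarrow> 'a) \<Rightarrow> nat \<Rightarrow> nat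
      \<Rightarrow> ('a list \<Rightarrow> 'a) \<Rightarrow> ('a list \<Rightarrow> 'a) \<Rightarrow> 'a list \<Rightarrow> 'a" where
  "gerstenhaber_bracket scale n m f g xs =
    circ (regular_bimodule scale) n m f g xs
    - scale ((-1) ^ ((n + 1) * (m + 1))) (circ (regular_bimodule scale) m n g f xs)"

text \<open>The isomorphism \<open>Z : A \<rightarrow> A\<^sup>*\<close> is \<open>form\<close> itself; it is onto the carrier of the dual bimodule.\<close>

definition Z_inv :: "('a \<Rightarrow> 'a \<Rightarrow> 'k) \<Rightarrow> ('a \<Rightarrow> 'k) \<Rightarrow> 'a" where
  "Z_inv form = inv form"

definition dual_mult ::
    "('a::{ring,monoid_mult} \<Rightarrow> 'a \<Rightarrow> 'k) \<Rightarrow> ('a \<Rightarrow> 'k) \<Rightarrow> ('a \<Rightarrow> 'k) \<Rightarrow> 'a \<Rightarrow> 'k" where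
  "dual_mult form \<phi> \<psi> = form (Z_inv form \<phi> * Z_inv form \<psi>)"

definition dual_bracket ::
    "('k::field \<Rightarrow> 'a::{ring,monoid_mult} \<Rightarrow> 'a) \<Rightarrow> ('a \<Rightarrow> 'a \<Rightarrow> 'k) \<Rightarrow> nat \<Rightarrow> nat
      \<Rightarrow> ('a list \<Rightarrow> 'a \<Rightarrow> 'k) \<Rightarrow> ('a list \<Rightarrow> 'a \<Rightarrow> 'k) \<Rightarrow> 'a list \<Rightarrow> 'a \<Rightarrow> 'k" where
  "dual_bracket scale form n m f g xs =
    circ (dual_bimodule scale) n m f (Z_inv form \<circ> g) xs
    - mscale (dual_bimodule scale) ((-1) ^ ((n + 1) * (m + 1)))
        (circ (dual_bimodule scale) m n g (Z_inv form \<circ> f) xs)"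

text \<open>
  Both operators below map degree \<open>n + 1\<close> to degree \<open>n\<close>.  In \<open>tradler_delta\<close> the list
  \<open>rotate (i - 1) (xs @ [a])\<close> is \<open>a\<^sub>i, \<dots>, a\<^sub>n\<^sub>+\<^sub>1, a\<^sub>1, \<dots>, a\<^sub>i\<^sub>-\<^sub>1\<close> with \<open>a = a\<^sub>n\<^sub>+\<^sub>1\<close>.
\<close>

definition tradler_delta ::
    "('a::{ring,monoid_mult} \<Rightarrow> 'a \<Rightarrow> 'k::field) \<Rightarrow> nat \<Rightarrow> ('a list \<Rightarrow> 'a) \<Rightarrow> 'a list \<Rightarrow> 'a" where
  "tradler_delta form n f xs =
    (if length xs = n then
       (THE b. \<forall>a. form b a =
          (\<Sum>i=1..n + 1. (-1) ^ (i * n) * form (f (rotate (i - 1) (xs @ [a]))) 1))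
     else 0)"

definition connes_B ::
    "nat \<Rightarrow> ('a::{ring,monoid_mult} list \<Rightarrow> 'a \<Rightarrow> 'k::field) \<Rightarrow> 'a list \<Rightarrow> 'a \<Rightarrow> 'k" where
  "connes_B n f xs =
    (if length xs = n then
       (\<lambda>a0. \<Sum>i=0..n. (-1) ^ (n * i) * f (rotate i (a0 # xs)) 1)
     else 0)"

section \<open>Graded spaces with a product, a bracket and a BV-operator\<close>

text \<open>
  The first arguments of type \<open>nat\<close> are degrees.  Components of negative degree vanish and are left
  out: the bracket of two elements of degree \<open>0\<close> is the zero of degree \<open>0 + 0 - 1 = 0\<close>, and
  \<open>bv_op n\<close> goes from degree \<open>n + 1\<close> to degree \<open>n\<close>.

  The Leibniz and BV identities are not imposed: for the unsigned cup product and the signs of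
  \<open>circ\<close> they hold only after a change of signs, whereas the notion of isomorphism involves
  the operations alone.
\<close>

record ('k, 'x) bv_structure =
  component :: "nat \<Rightarrow> 'x set"
  gadd :: "nat \<Rightarrow> 'x \<Rightarrow> 'x \<Rightarrow> 'x"
  gscale :: "nat \<Rightarrow> 'k \<Rightarrow> 'x \<Rightarrow> 'x"
  product :: "nat \<Rightarrow> nat \<Rightarrow> 'x \<Rightarrow> 'x \<Rightarrow> 'x"
  bracket :: "nat \<Rightarrow> nat \<Rightarrow> 'x \<Rightarrow> 'x \<Rightarrow> 'x"
  bv_op :: "nat \<Rightarrow> 'x \<Rightarrow> 'x"

definition operations_well_defined :: "('k, 'x) bv_structure \<Rightarrow> bool" where
  "operations_well_defined H \<longleftrightarrow>
    (\<forall>n. \<forall>x\<in>component H n. \<forall>y\<in>component H n. gadd H n x y \<in> component H n) \<and>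
    (\<forall>n c. \<forall>x\<in>component H n. gscale H n c x \<in> component H n) \<and>
    (\<forall>n m. \<forall>x\<in>component H n. \<forall>y\<in>component H m. product H n m x y \<in> component H (n + m)) \<and>
    (\<forall>n m. \<forall>x\<in>component H n. \<forall>y\<in>component H m. bracket H n m x y \<in> component H (n + m - 1)) \<and>
    (\<forall>n. \<forall>x\<in>component H (Suc n). bv_op H n x \<in> component H n)"

definition bv_isomorphism ::
    "(nat \<Rightarrow> 'x \<Rightarrow> 'y) \<Rightarrow> ('k, 'x) bv_structure \<Rightarrow> ('k, 'y) bv_structure \<Rightarrow> bool" where
  "bv_isomorphism \<Phi> H K \<longleftrightarrow>
    (\<forall>n. bij_betw (\<Phi> n) (component H n) (component K n)) \<and>
    (\<forall>n. \<forall>x\<in>component H n. \<forall>y\<in>component H n.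
       \<Phi> n (gadd H n x y) = gadd K n (\<Phi> n x) (\<Phi> n y)) \<and>
    (\<forall>n c. \<forall>x\<in>component H n. \<Phi> n (gscale H n c x) = gscale K n c (\<Phi> n x)) \<and>
    (\<forall>n m. \<forall>x\<in>component H n. \<forall>y\<in>component H m.
       \<Phi> (n + m) (product H n m x y) = product K n m (\<Phi> n x) (\<Phi> m y)) \<and>
    (\<forall>n m. \<forall>x\<in>component H n. \<forall>y\<in>component H m.
       \<Phi> (n + m - 1) (bracket H n m x y) = bracket K n m (\<Phi> n x) (\<Phi> m y)) \<and>
    (\<forall>n. \<forall>x\<in>component H (Suc n). \<Phi> n (bv_op H n x) = bv_op K n (\<Phi> (Suc n) x))"

definition bv_isomorphic :: "('k, 'x) bv_structure \<Rightarrow> ('k, 'y) bv_structure \<Rightarrow> bool" where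
  "bv_isomorphic H K \<longleftrightarrow> (\<exists>\<Phi>. bv_isomorphism \<Phi> H K)"

definition cohomology_bv_structure ::
    "('k::field \<Rightarrow> 'a::{ring,monoid_mult} \<Rightarrow> 'a) \<Rightarrow> ('k, 'a, 'm::ab_group_add) bimodule
      \<Rightarrow> (nat \<Rightarrow> nat \<Rightarrow> ('a list \<Rightarrow> 'm) \<Rightarrow> ('a list \<Rightarrow> 'm) \<Rightarrow> 'a list \<Rightarrow> 'm)
      \<Rightarrow> (nat \<Rightarrow> nat \<Rightarrow> ('a list \<Rightarrow> 'm) \<Rightarrow> ('a list \<Rightarrow> 'm) \<Rightarrow> 'a list \<Rightarrow> 'm)
      \<Rightarrow> (nat \<Rightarrow> ('a list \<Rightarrow> 'm) \<Rightarrow> 'a list \<Rightarrow> 'm)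
      \<Rightarrow> ('k, ('a list \<Rightarrow> 'm) set) bv_structure" where
  "cohomology_bv_structure scale M prd brk dlt =
    \<lparr>component = hochschild_cohomology scale M,
     gadd = (\<lambda>n. induced2 (cohomologous scale M n) (+)),
     gscale = (\<lambda>n c. induced1 (cohomologous scale M n) (\<lambda>f xs. mscale M c (f xs))),
     product = (\<lambda>n m. induced2 (cohomologous scale M (n + m)) (prd n m)),
     bracket = (\<lambda>n m. induced2 (cohomologous scale M (n + m - 1)) (brk n m)),
     bv_op = (\<lambda>n. induced1 (cohomologous scale M n) (dlt n))\<rparr>"

text \<open>\<open>(HH\<^sup>\<bullet>(A), \<union>, [ , ], \<Delta>)\<close>\<close>

definition HH_bv ::
    "('k::field \<Rightarrow> 'a::{ring,monoid_mult} \<Rightarrow> 'a) \<Rightarrow> ('a \<Rightarrow> 'a \<Rightarrow> 'k)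
      \<Rightarrow> ('k, ('a list \<Rightarrow> 'a) set) bv_structure" where
  "HH_bv scale form =
    cohomology_bv_structure scale (regular_bimodule scale)
      (cup (*)) (gerstenhaber_bracket scale) (tradler_delta form)"

text \<open>\<open>(H\<^sup>\<bullet>(A, A\<^sup>*), \<union>\<^sub>*, [ , ]\<^sub>*, B)\<close>\<close>

definition H_dual_bv ::
    "('k::field \<Rightarrow> 'a::{ring,monoid_mult} \<Rightarrow> 'a) \<Rightarrow> ('a \<Rightarrow> 'a \<Rightarrow> 'k)
      \<Rightarrow> ('k, ('a list \<Rightarrow> 'a \<Rightarrow> 'k) set) bv_structure" where
  "H_dual_bv scale form =
    cohomology_bv_structure scale (dual_bimodule scale)
      (cup (dual_mult form)) (dual_bracket scale form) connes_B"

end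

theory Submission
  imports Defs
begin

text \<open>
  Composition with \<open>Z : A \<rightarrow> A\<^sup>*\<close> carries cochains with values in \<open>A\<close> to cochains with values in \<open>A\<^sup>*\<close>.
  Since \<open>Z\<close> is an isomorphism of bimodules (onto \<open>A\<^sup>*\<close> by finite dimension, \<open>form_onto_dual\<close>), this is an
  isomorphism of complexes, and it matches the cup products, the brackets and the two operators already
  on cochains.  Its direct image on classes is therefore the wanted isomorphism
  (\<open>Z_cochain_bv_isomorphism\<close>).

  It remains to see that the operations descend to cohomology.  Well-definedness passes along an
  isomorphism (\<open>well_defined_transport\<close>), so only \<open>HH\<^sup>\<bullet>(A)\<close> has to be treated, one operation at a time.

  For the cup product, the differential is a graded derivation (\<open>\<delta>_cup\<close>).

  For the bracket, let \<open>\<mu>\<close> be the multiplication of \<open>A\<close>, seen as a 2-cochain.  Then \<open>\<delta>f = -[f, \<mu>]\<close>, and the graded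
  Jacobi identity shows that \<open>\<delta>\<close> is a derivation of the bracket (\<open>\<delta>_bracket\<close>).  The Jacobi identity in turn
  holds because the associator of insertion is graded symmetric in its last two arguments: in
  \<open>(f \<circ> g) \<circ> h\<close> the cochain \<open>h\<close> goes either into \<open>g\<close>, which gives \<open>f \<circ> (g \<circ> h)\<close>, or into another slot of
  \<open>f\<close>, which is symmetric in \<open>g\<close> and \<open>h\<close> up to sign (\<open>brace_brace\<close>).

  For \<open>\<Delta>\<close>, which \<open>Z\<close> turns into Connes' operator \<open>B\<close>, the point is that \<open>B\<close> anticommutes with the
  Hochschild differential (\<open>connes_B_anticommutes\<close>).  Here \<open>B = N s\<close> with \<open>s\<close> the insertion of the unit and \<open>N\<close>
  the cyclic sum, without the factor \<open>1 - t\<close> that the definition on cochains that are not normalized usually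
  has.  The identity still holds for all cochains: the two faces of \<open>s\<close> that multiply by the inserted
  unit are cyclic rotations of each other with opposite signs, so \<open>N\<close> cancels them, and the remaining
  faces are those of the cyclically symmetrized cochain.
\<close>

section \<open>Signs\<close>

text \<open>
  Multiplication by \<open>(-1)\<^sup>k\<close> without reference to a scalar action, so that the sign computations are the
  same for \<open>A\<close>, \<open>A\<^sup>*\<close> and \<open>k\<close>.
\<close>

definition signed :: "nat \<Rightarrow> 'm::ab_group_add \<Rightarrow> 'm" where
  "signed k x = (if even k then x else - x)"

lemma signed_add_left: "signed (j + k) x = signed j (signed k x)"
  by (auto simp: signed_def)

lemma signed_zero [simp]: "signed k 0 = 0"
  by (simp add: signed_def)

lemma signed_plus: "signed k (x + y) = signed k x + signed k y"
  by (simp add: signed_def)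

lemma signed_sum: "signed k (sum f I) = (\<Sum>i\<in>I. signed k (f i))"
  by (simp add: signed_def sum_negf)

lemma signed_cong: "even j = even k \<Longrightarrow> signed j x = signed k x"
  by (simp add: signed_def)

section \<open>Insertion of cochains and the Jacobi identity\<close>

text \<open>
  Gerstenhaber's insertion \<open>f \<circ> h\<close> without scalars: for values in \<open>A\<close> it is \<open>circ\<close>, but its identities concern
  slotwise additive functions on lists only.
\<close>

definition brace ::
  "nat \<Rightarrow> nat \<Rightarrow> ('a list \<Rightarrow> 'm) \<Rightarrow> ('a list \<Rightarrow> 'a) \<Rightarrow> 'a list \<Rightarrow> 'm::ab_group_add" where
  "brace n m f h xs =
    (if length xs + 1 = n + m then
       (\<Sum>i<n. signed (i * (m + 1))
          (f (take i xs @ [h (take m (drop i xs))] @ drop (i + m) xs)))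
     else 0)"

lemma brace_eq_0: "length xs + 1 \<noteq> n + m \<Longrightarrow> brace n m f h xs = 0"
  by (simp add: brace_def)

lemma brace_0 [simp]: "brace 0 m f h = (\<lambda>_. 0)"
  by (rule ext) (simp add: brace_def)

lemma brace_zero_left [simp]: "brace n m (\<lambda>_. 0) h = (\<lambda>_. 0)"
  by (rule ext) (simp add: brace_def)

text \<open>
  The simultaneous insertion of \<open>g\<close> and \<open>h\<close> into two different slots of \<open>f\<close>, with \<open>h\<close> (slot \<open>j\<close>) to the left
  of \<open>g\<close> (slot \<open>i\<close>).  The sign is the one with which this term occurs in \<open>(f \<circ> g) \<circ> h\<close>.
\<close>

definition brace2 ::
  "nat \<Rightarrow> nat \<Rightarrow> nat \<Rightarrow> ('a list \<Rightarrow> 'm) \<Rightarrow> ('a list \<Rightarrow> 'a) \<Rightarrow> ('a list \<Rightarrow> 'a)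
    \<Rightarrow> 'a list \<Rightarrow> 'm::ab_group_add" where
  "brace2 n m p f g h xs =
    (if length xs + 2 = n + m + p then
       (\<Sum>i<n. \<Sum>j<i. signed (i * (m + 1) + j * (p + 1))
          (f (take j xs @ [h (take p (drop j xs))] @ take (i - j - 1) (drop (j + p) xs)
              @ [g (take m (drop (i + p - 1) xs))] @ drop (i + p - 1 + m) xs)))
     else 0)"

definition slotwise_additive :: "nat \<Rightarrow> ('a::ab_group_add list \<Rightarrow> 'm::ab_group_add) \<Rightarrow> bool" where
  "slotwise_additive n f \<longleftrightarrow> (\<forall>xs ys a b. length xs + length ys + 1 = n \<longrightarrow>
     f (xs @ [a + b] @ ys) = f (xs @ [a] @ ys) + f (xs @ [b] @ ys))"

lemma slotwise_additive_zero:
  assumes "slotwise_additive n f" "length xs + length ys + 1 = n"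
  shows "f (xs @ [0] @ ys) = 0"
  using assms unfolding slotwise_additive_def by (metis add.right_neutral add_left_cancel)

lemma slotwise_additive_minus:
  assumes "slotwise_additive n f" "length xs + length ys + 1 = n"
  shows "f (xs @ [- a] @ ys) = - f (xs @ [a] @ ys)"
proof -
  have "f (xs @ [- a] @ ys) + f (xs @ [a] @ ys) = f (xs @ [- a + a] @ ys)"
    using assms unfolding slotwise_additive_def by metis
  also have "\<dots> = 0"
    using slotwise_additive_zero[OF assms] by simp
  finally show ?thesis by (simp add: eq_neg_iff_add_eq_0)
qed

lemma slotwise_additive_signed:
  assumes "slotwise_additive n f" "length xs + length ys + 1 = n"
  shows "f (xs @ [signed k a] @ ys) = signed k (f (xs @ [a] @ ys))"
  using slotwise_additive_minus[OF assms] by (simp add: signed_def)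

lemma slotwise_additive_sum:
  assumes "slotwise_additive n f" "length xs + length ys + 1 = n"
  shows "f (xs @ [sum u I] @ ys) = (\<Sum>i\<in>I. f (xs @ [u i] @ ys))"
proof (induction I rule: infinite_finite_induct)
  case (insert x F)
  then show ?case
    using assms unfolding slotwise_additive_def by (metis sum.insert)
qed (use slotwise_additive_zero[OF assms] in simp_all)

lemma sum_triangle_swap:
  fixes u :: "nat \<Rightarrow> nat \<Rightarrow> 'm::comm_monoid_add"
  shows "(\<Sum>i<n. \<Sum>j=i+1..<n. u i j) = (\<Sum>j<n. \<Sum>i<j. u i j)"
proof -
  have "(\<Sum>i<n. \<Sum>j=i+1..<n. u i j) = (\<Sum>(i, j)\<in>Sigma {..<n} (\<lambda>i. {i+1..<n}). u i j)"
    by (rule sum.Sigma) auto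
  also have "\<dots> = (\<Sum>(j, i)\<in>Sigma {..<n} (\<lambda>j. {..<j}). u i j)"
    by (rule sum.reindex_bij_witness[where i="\<lambda>(j, i). (i, j)" and j="\<lambda>(i, j). (j, i)"]) auto
  also have "\<dots> = (\<Sum>j<n. \<Sum>i<j. u i j)"
    by (rule sum.Sigma[symmetric]) auto
  finally show ?thesis .
qed

text \<open>
  The pre-Lie identity.  Write \<open>(f \<circ> g) \<circ> h\<close> as a double sum over the slot \<open>i\<close> of \<open>f\<close> that receives \<open>g\<close> and the
  position \<open>j\<close> at which \<open>h\<close> is inserted.  If \<open>j < i\<close>, then \<open>h\<close> lies to the left of \<open>g\<close>; if \<open>i \<le> j < i + m\<close>, it is
  inserted into \<open>g\<close>; if \<open>i + m \<le> j\<close>, it lies to the right of \<open>g\<close>, in slot \<open>j + 1 - m\<close> of \<open>f\<close>, and these terms are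
  the ones of the first kind with \<open>g\<close> and \<open>h\<close> exchanged.  The degree \<open>n + m - 1\<close> is truncated only if
  \<open>n = 0\<close>, when all terms vanish, and \<open>m + p - 1\<close> only if \<open>m = p = 0\<close>, when \<open>g \<circ> h\<close> and with it \<open>f \<circ> (g \<circ> h)\<close>
  vanishes.
\<close>

lemma brace_brace:
  assumes f: "slotwise_additive n f"
  shows "brace (n + m - 1) p (brace n m f g) h xs =
    brace n (m + p - 1) f (brace m p g h) xs
    + brace2 n m p f g h xs + signed ((m + 1) * (p + 1)) (brace2 n p m f h g xs)"
proof (cases "length xs + 2 = n + m + p \<and> n > 0")
  case False
  have "brace (n + m - 1) p (brace n m f g) h xs = 0"
  proof (cases "n = 0")
    case n: False
    then have "length xs + 1 \<noteq> n + m - 1 + p" using False by linarith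
    then show ?thesis by (rule brace_eq_0)
  qed simp
  moreover have "brace n (m + p - 1) f (brace m p g h) xs = 0"
  proof (cases "n > 0 \<and> length xs + 1 = n + (m + p - 1)")
    case True
    then have "m = 0" "p = 0" "length xs + 1 = n" using False by auto
    then show ?thesis
      using slotwise_additive_zero[OF f]
      by (auto simp: brace_def intro!: sum.neutral)
  qed (auto simp: brace_def)
  moreover have "brace2 n m p f g h xs = 0" "brace2 n p m f h g xs = 0"
    using False by (auto simp: brace2_def)
  ultimately show ?thesis by simp
next
  case True
  then have len: "length xs + 2 = n + m + p" and n: "n > 0" by auto
  \<comment> \<open>\<open>ys j\<close> is the argument of \<open>f \<circ> g\<close> after \<open>h\<close> has been inserted at position \<open>j\<close>.\<close>
  define ys where "ys j = take j xs @ [h (take p (drop j xs))] @ drop (j + p) xs" for j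
  define T where "T i j = signed (j * (p + 1)) (signed (i * (m + 1))
      (f (take i (ys j) @ [g (take m (drop i (ys j)))] @ drop (i + m) (ys j))))" for i j
  have "brace (n + m - 1) p (brace n m f g) h xs =
      (\<Sum>j<n+m-1. signed (j * (p + 1)) (brace n m f g (ys j)))"
    using len n by (simp add: brace_def ys_def)
  also have "\<dots> = (\<Sum>j<n+m-1. \<Sum>i<n. T i j)"
  proof (rule sum.cong)
    fix j assume "j \<in> {..<n+m-1}"
    then have "length (ys j) + 1 = n + m" using len n by (auto simp: ys_def)
    then show "signed (j * (p + 1)) (brace n m f g (ys j)) = (\<Sum>i<n. T i j)"
      by (simp add: brace_def T_def signed_sum)
  qed simp
  also have "\<dots> = (\<Sum>i<n. \<Sum>j<n+m-1. T i j)"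
    by (rule sum.swap)
  also have "\<dots> = (\<Sum>i<n. (\<Sum>j<i. T i j) + (\<Sum>j=i..<i+m. T i j) + (\<Sum>j=i+m..<n+m-1. T i j))"
  proof (rule sum.cong)
    fix i assume "i \<in> {..<n}"
    then have "i + m \<le> n + m - 1" using n by auto
    then show "(\<Sum>j<n+m-1. T i j) =
        (\<Sum>j<i. T i j) + (\<Sum>j=i..<i+m. T i j) + (\<Sum>j=i+m..<n+m-1. T i j)"
      using sum.atLeastLessThan_concat[of 0 i "i+m" "T i"]
        sum.atLeastLessThan_concat[of 0 "i+m" "n+m-1" "T i"]
      by (simp add: lessThan_atLeast0)
  qed simp
  also have "\<dots> = (\<Sum>i<n. \<Sum>j<i. T i j) + (\<Sum>i<n. \<Sum>j=i..<i+m. T i j)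
      + (\<Sum>i<n. \<Sum>j=i+m..<n+m-1. T i j)"
    by (simp add: sum.distrib)
  also have "(\<Sum>i<n. \<Sum>j<i. T i j) = brace2 n m p f g h xs"
  proof -
    have "T i j = signed (i * (m + 1) + j * (p + 1))
          (f (take j xs @ [h (take p (drop j xs))] @ take (i - j - 1) (drop (j + p) xs)
              @ [g (take m (drop (i + p - 1) xs))] @ drop (i + p - 1 + m) xs))"
      if "i < n" "j < i" for i j
    proof -
      obtain d where i: "i = j + Suc d" using less_imp_Suc_add[OF \<open>j < i\<close>] by auto
      have "j \<le> length xs" using len that n by linarith
      moreover have "j + p + d \<le> length xs" using len that n i by linarith
      ultimately show ?thesis
        by (simp add: T_def ys_def i signed_add_left[symmetric] add_ac)
    qed
    then show ?thesis using len by (simp add: brace2_def)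
  qed
  also have "(\<Sum>i<n. \<Sum>j=i..<i+m. T i j) = brace n (m + p - 1) f (brace m p g h) xs"
  proof (cases "m = 0")
    case True
    have "brace n (m + p - 1) f (brace m p g h) xs = 0"
      using slotwise_additive_zero[OF f] len True
      by (auto simp: brace_def intro!: sum.neutral)
    then show ?thesis using True by simp
  next
    case False
    have "(\<Sum>j=i..<i+m. T i j) = signed (i * (m + p - 1 + 1))
        (f (take i xs @ [brace m p g h (take (m + p - 1) (drop i xs))] @ drop (i + (m + p - 1)) xs))"
      if "i < n" for i
    proof -
      let ?zs = "take (m + p - 1) (drop i xs)"
      have il: "i + (m + p - 1) \<le> length xs" using that len False by linarith
      have lens: "length (take i xs) + length (drop (i + (m + p - 1)) xs) + 1 = n"
        using il len False by simp
      have T: "T i (i + k) = signed (i * (m + p - 1 + 1)) (signed (k * (p + 1))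
          (f (take i xs @ [g (take k ?zs @ [h (take p (drop k ?zs))] @ drop (k + p) ?zs)]
              @ drop (i + (m + p - 1)) xs)))" if "k < m" for k
      proof -
        \<comment> \<open>The arguments split into those of \<open>f\<close> before \<open>g\<close>, of \<open>g\<close> before \<open>h\<close>, of \<open>h\<close>, of \<open>g\<close> after \<open>h\<close>, and of
          \<open>f\<close> after \<open>g\<close>.\<close>
        define r where "r = m - 1 - k"
        have m: "m = Suc (k + r)" using that by (simp add: r_def)
        define u1 where "u1 = take i xs"
        define u2 where "u2 = take k (drop i xs)"
        define u3 where "u3 = take p (drop (i + k) xs)"
        define u4 where "u4 = take r (drop (i + k + p) xs)"
        define u5 where "u5 = drop (i + k + p + r) xs"
        have xs: "xs = u1 @ u2 @ u3 @ u4 @ u5"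
          unfolding u1_def u2_def u3_def u4_def u5_def
          by (metis append_take_drop_id drop_drop add.commute)
        have "length u1 = i" "length u2 = k" "length u3 = p" "length u4 = r"
          using il m by (auto simp: u1_def u2_def u3_def u4_def)
        then have args: "take i (ys (i + k)) @ [g (take m (drop i (ys (i + k))))] @ drop (i + m) (ys (i + k))
            = take i xs @ [g (take k ?zs @ [h (take p (drop k ?zs))] @ drop (k + p) ?zs)]
              @ drop (i + (m + p - 1)) xs"
          by (simp add: xs ys_def m)
        have "even ((i + k) * (p + 1) + i * (m + 1)) = even (i * (m + p - 1 + 1) + k * (p + 1))"
          using m by auto
        from signed_cong[OF this] show ?thesis
          unfolding T_def args signed_add_left by simp
      qed
      have "(\<Sum>j=i..<i+m. T i j) = (\<Sum>k<m. T i (i + k))"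
        using sum.shift_bounds_nat_ivl[of "T i" 0 i m] by (simp add: lessThan_atLeast0 add.commute)
      also have "\<dots> = signed (i * (m + p - 1 + 1)) (\<Sum>k<m.
          f (take i xs @ [signed (k * (p + 1)) (g (take k ?zs @ [h (take p (drop k ?zs))] @ drop (k + p) ?zs))]
              @ drop (i + (m + p - 1)) xs))"
        unfolding slotwise_additive_signed[OF f lens] signed_sum
        by (intro sum.cong refl T) simp
      also have "\<dots> = signed (i * (m + p - 1 + 1))
        (f (take i xs @ [brace m p g h ?zs] @ drop (i + (m + p - 1)) xs))"
        unfolding slotwise_additive_sum[OF f lens, symmetric] using il False by (simp add: brace_def)
      finally show ?thesis .
    qed
    then show ?thesis using len False by (simp add: brace_def[of n])
  qed
  also have "(\<Sum>i<n. \<Sum>j=i+m..<n+m-1. T i j) = signed ((m + 1) * (p + 1)) (brace2 n p m f h g xs)"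
  proof -
    have "(\<Sum>i<n. \<Sum>j=i+m..<n+m-1. T i j) = (\<Sum>i<n. \<Sum>j=i+1..<n. T i (j + m - 1))"
    proof (rule sum.cong)
      fix i assume "i \<in> {..<n}"
      show "(\<Sum>j=i+m..<n+m-1. T i j) = (\<Sum>j=i+1..<n. T i (j + m - 1))"
        by (rule sum.reindex_bij_witness[where i="\<lambda>j. j + m - 1" and j="\<lambda>j. j + 1 - m"]) auto
    qed simp
    also have "\<dots> = (\<Sum>j<n. \<Sum>i<j. T i (j + m - 1))"
      by (rule sum_triangle_swap)
    also have "\<dots> = signed ((m + 1) * (p + 1)) (brace2 n p m f h g xs)"
    proof -
      have "T i (j + m - 1) = signed ((m + 1) * (p + 1)) (signed (j * (p + 1) + i * (m + 1))
          (f (take i xs @ [g (take m (drop i xs))] @ take (j - i - 1) (drop (i + m) xs)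
              @ [h (take p (drop (j + m - 1) xs))] @ drop (j + m - 1 + p) xs)))"
        if "j < n" "i < j" for i j
      proof -
        obtain d where j: "j = i + Suc d" using less_imp_Suc_add[OF \<open>i < j\<close>] by auto
        have le: "i + m + d + p \<le> length xs" using len that n j by linarith
        have "even ((i + d + m) * (p + 1) + i * (m + 1)) =
           even ((m + 1) * (p + 1) + (Suc (i + d) * (p + 1) + i * (m + 1)))"
          by auto
        note sign = signed_cong[OF this]
        have args: "take i (ys (i + d + m)) @ [g (take m (drop i (ys (i + d + m))))] @ drop (i + m) (ys (i + d + m))
            = take i xs @ [g (take m (drop i xs))] @ take d (drop (i + m) xs)
              @ [h (take p (drop (i + d + m) xs))] @ drop (i + d + m + p) xs"
          using le by (simp add: ys_def drop_take min_def add_ac)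
        have "j + m - 1 = i + d + m" "j - i - 1 = d" "j = Suc (i + d)" by (simp_all add: j)
        then show ?thesis
          by (simp only: T_def args signed_add_left[symmetric] sign)
      qed
      then show ?thesis using len by (simp add: brace2_def signed_sum)
    qed
    finally show ?thesis .
  qed
  finally show ?thesis by (simp add: add_ac)
qed

lemma list_update_middle:
  assumes "i < length xs"
  shows "xs[i := a] = take i xs @ [a] @ drop (Suc i) xs"
  using upd_conv_take_nth_drop[OF assms, of a] by simp

text \<open>
  Multilinearity in terms of a list split around the varying entry, a form that is easier to combine with
  \<open>take\<close> and \<open>drop\<close> than list updates.
\<close>

lemma cochains_slotI:
  assumes "\<And>xs. length xs \<noteq> n \<Longrightarrow> f xs = 0"
    and "\<And>xs. length xs = n \<Longrightarrow> f xs \<in> mcarrier M"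
    and "\<And>us vs. length us + length vs + 1 = n \<Longrightarrow>
      Vector_Spaces.linear scale (mscale M) (\<lambda>a. f (us @ [a] @ vs))"
  shows "f \<in> cochains scale M n"
  unfolding cochains_def
proof (intro CollectI conjI allI impI)
  fix xs :: "'a list" and i assume "length xs = n" "i < n"
  then show "Vector_Spaces.linear scale (mscale M) (\<lambda>a. f (xs[i := a]))"
    using assms(3)[of "take i xs" "drop (Suc i) xs"] by (simp add: list_update_middle)
qed (use assms in auto)

lemma cochains_slotD:
  assumes "f \<in> cochains scale M n" "length us + length vs + 1 = n"
  shows "Vector_Spaces.linear scale (mscale M) (\<lambda>a. f (us @ [a] @ vs))"
proof -
  have "length (us @ [undefined] @ vs) = n" "length us < n" using assms(2) by auto
  then have "Vector_Spaces.linear scale (mscale M) (\<lambda>a. f ((us @ [undefined] @ vs)[length us := a]))"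
    using assms(1) unfolding cochains_def by blast
  then show ?thesis by (simp add: list_update_append)
qed

lemma cochains_length: "f \<in> cochains scale M n \<Longrightarrow> length xs \<noteq> n \<Longrightarrow> f xs = 0"
  by (simp add: cochains_def)

lemma cochains_carrier: "f \<in> cochains scale M n \<Longrightarrow> length xs = n \<Longrightarrow> f xs \<in> mcarrier M"
  by (simp add: cochains_def)

lemma cochains_additive: "f \<in> cochains scale M n \<Longrightarrow> slotwise_additive n f"
  using cochains_slotD unfolding slotwise_additive_def Vector_Spaces.linear_iff by blast

definition mult_cochain :: "'a::{ring,monoid_mult} list \<Rightarrow> 'a" where
  "mult_cochain xs = (if length xs = 2 then xs ! 0 * xs ! 1 else 0)"

definition brace_bracket ::
  "nat \<Rightarrow> nat \<Rightarrow> ('a list \<Rightarrow> 'a::ab_group_add) \<Rightarrow> ('a list \<Rightarrow> 'a) \<Rightarrow> 'a list \<Rightarrow> 'a" where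
  "brace_bracket n m f g xs =
    brace n m f g xs - signed ((n + 1) * (m + 1)) (brace m n g f xs)"

lemma brace_diff_left:
  "brace n m (\<lambda>xs. f xs - signed k (f' xs)) g xs = brace n m f g xs - signed k (brace n m f' g xs)"
  by (auto simp: brace_def signed_def sum_subtractf[symmetric] sum_negf[symmetric] sum.distrib[symmetric]
      intro!: sum.cong)

lemma brace_uminus_left: "brace n m (\<lambda>xs. - f xs) g xs = - brace n m f g xs"
  by (auto simp: brace_def signed_def sum_negf[symmetric] intro!: sum.cong)

lemma slotwise_additive_diff:
  assumes "slotwise_additive n f" "length xs + length ys + 1 = n"
  shows "f (xs @ [a - b] @ ys) = f (xs @ [a] @ ys) - f (xs @ [b] @ ys)"
proof -
  have "f (xs @ [a + - b] @ ys) = f (xs @ [a] @ ys) + f (xs @ [- b] @ ys)"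
    using assms unfolding slotwise_additive_def by metis
  then show ?thesis using slotwise_additive_minus[OF assms] by simp
qed

lemma brace_diff_right:
  assumes "slotwise_additive n f"
  shows "brace n m f (\<lambda>xs. g xs - signed k (g' xs)) xs =
    brace n m f g xs - signed k (brace n m f g' xs)"
proof (cases "length xs + 1 = n + m")
  case True
  have "f (take i xs @ [a - signed k b] @ drop (i + m) xs) =
      f (take i xs @ [a] @ drop (i + m) xs) - signed k (f (take i xs @ [b] @ drop (i + m) xs))"
    if "i < n" for i a b
  proof -
    have "length (take i xs) + length (drop (i + m) xs) + 1 = n" using that True by auto
    from slotwise_additive_diff[OF assms this] slotwise_additive_signed[OF assms this]
    show ?thesis by simp
  qed
  then have "brace n m f (\<lambda>xs. g xs - signed k (g' xs)) xs = (\<Sum>i<n. signed (i * (m + 1))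
      (f (take i xs @ [g (take m (drop i xs))] @ drop (i + m) xs)
       - signed k (f (take i xs @ [g' (take m (drop i xs))] @ drop (i + m) xs))))"
    using True by (simp add: brace_def)
  also have "\<dots> = brace n m f g xs - signed k (brace n m f g' xs)"
    using True by (auto simp: brace_def signed_def sum_subtractf[symmetric] sum_negf[symmetric] sum.distrib[symmetric]
      intro!: sum.cong)
  finally show ?thesis .
qed (simp add: brace_def)

lemma brace_uminus_right:
  assumes "slotwise_additive n f"
  shows "brace n m f (\<lambda>xs. - g xs) xs = - brace n m f g xs"
proof (cases "length xs + 1 = n + m")
  case True
  have "f (take i xs @ [- b] @ drop (i + m) xs) = - f (take i xs @ [b] @ drop (i + m) xs)"
    if "i < n" for i b
  proof -
    have "length (take i xs) + length (drop (i + m) xs) + 1 = n" using that True by auto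
    from slotwise_additive_minus[OF assms this] show ?thesis .
  qed
  then show ?thesis
    using True by (auto simp: brace_def signed_def sum_negf[symmetric] intro!: sum.cong)
qed (simp add: brace_def)

text \<open>
  Expanding all brackets gives iterated insertions of both bracketings.  After \<open>brace_brace\<close> has replaced each
  \<open>(x \<circ> y) \<circ> z\<close> by \<open>x \<circ> (y \<circ> z)\<close> and the two disjoint insertions, everything cancels, whatever the parities.
  The condition \<open>p > 0\<close> makes \<open>m + p - 1\<close> and \<open>n + p - 1\<close> true degrees.
\<close>

lemma brace_bracket_jacobi:
  assumes f: "slotwise_additive n f" and g: "slotwise_additive m g" and h: "slotwise_additive p h"
    and p: "p > 0"
  shows "brace_bracket (n + m - 1) p (brace_bracket n m f g) h xs =
    brace_bracket n (m + p - 1) f (brace_bracket m p g h) xs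
    + signed ((m + 1) * (p + 1)) (brace_bracket (n + p - 1) m (brace_bracket n p f h) g xs)"
proof -
  \<comment> \<open>The truncation in \<open>n + m - 1\<close> takes effect only for \<open>n = m = 0\<close>, when the bracket of \<open>f\<close> and \<open>g\<close> is \<open>0\<close>.\<close>
  have sign: "signed ((n + m - 1 + 1) * (p + 1)) (brace p (n + m - 1) h (brace_bracket n m f g) xs)
      = signed ((n + m) * (p + 1)) (brace p (n + m - 1) h (brace_bracket n m f g) xs)"
  proof (cases "n + m = 0")
    case True
    then have "brace_bracket n m f g = (\<lambda>_. - 0)" by (simp add: brace_bracket_def fun_eq_iff)
    then show ?thesis using brace_uminus_right[OF h, of _ "\<lambda>_. 0" xs] by (simp add: signed_def)
  qed simp
  have p1: "m + p - 1 + 1 = m + p" "n + p - 1 + 1 = n + p" using p by auto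
  have ac: "m + n = n + m" "p + n = n + p" "p + m = m + p" by simp_all
  note assoc =
    brace_brace[OF f, of m p g h xs] brace_brace[OF f, of p m h g xs]
    brace_brace[OF g, of n p f h xs] brace_brace[OF g, of p n h f xs]
    brace_brace[OF h, of n m f g xs] brace_brace[OF h, of m n g f xs]
  show ?thesis
    unfolding brace_bracket_def[of "n + m - 1"] brace_bracket_def[of "n"  "m + p - 1"]
       brace_bracket_def[of "n + p - 1"] sign p1
    unfolding brace_bracket_def[abs_def] brace_diff_left brace_diff_right[OF f] brace_diff_right[OF g]
       brace_diff_right[OF h]
    unfolding assoc[unfolded ac]
    by (cases "even n"; cases "even m"; cases "even p") (simp_all add: signed_def algebra_simps)
qed

section \<open>The Hochschild complex of the algebra\<close>

context k_algebra
begin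

abbreviation R :: "('k, 'a, 'a) bimodule" where "R \<equiv> regular_bimodule scale"

abbreviation lin :: "('a \<Rightarrow> 'a) \<Rightarrow> bool" where "lin \<equiv> Vector_Spaces.linear scale scale"

lemma scale_sign: "scale ((-1) ^ k) x = signed k x"
  by (cases "even k") (simp_all add: signed_def)

lemma lin_iff: "lin f \<longleftrightarrow> (\<forall>a b. f (a + b) = f a + f b) \<and> (\<forall>c a. f (scale c a) = scale c (f a))"
  by (simp add: Vector_Spaces.linear_iff vector_space_axioms)

lemma lin_zero: "lin (\<lambda>_. 0)"
  by (simp add: lin_iff)

lemma lin_id: "lin (\<lambda>a. a)"
  by (simp add: lin_iff)

lemma lin_add: "lin f \<Longrightarrow> lin g \<Longrightarrow> lin (\<lambda>a. f a + g a)"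
  by (simp add: lin_iff scale_right_distrib algebra_simps)

lemma lin_diff: "lin f \<Longrightarrow> lin g \<Longrightarrow> lin (\<lambda>a. f a - g a)"
  by (simp add: lin_iff scale_right_diff_distrib algebra_simps)

lemma lin_scale: "lin f \<Longrightarrow> lin (\<lambda>a. scale c (f a))"
  by (simp add: lin_iff scale_right_distrib mult.commute)

lemma lin_sum: "(\<And>i. i \<in> I \<Longrightarrow> lin (u i)) \<Longrightarrow> lin (\<lambda>a. \<Sum>i\<in>I. u i a)"
  by (induction I rule: infinite_finite_induct) (simp_all add: lin_zero lin_add)

lemma lin_compose: "lin f \<Longrightarrow> lin g \<Longrightarrow> lin (\<lambda>a. f (g a))"
  by (simp add: lin_iff)

lemma lin_mult_left: "lin f \<Longrightarrow> lin (\<lambda>a. f a * b)"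
  by (simp add: lin_iff scale_mult_left distrib_right)

lemma lin_mult_right: "lin f \<Longrightarrow> lin (\<lambda>a. b * f a)"
  by (simp add: lin_iff scale_mult_right distrib_left)

abbreviation C :: "nat \<Rightarrow> ('a list \<Rightarrow> 'a) set" where "C \<equiv> cochains scale R"

lemma regular_simps [simp]:
  "mcarrier R = UNIV" "mscale R = scale" "lact R = (*)" "ract R = (*)"
  by (simp_all add: regular_bimodule_def)

lemma C_slot: "f \<in> C n \<Longrightarrow> length us + length vs + 1 = n \<Longrightarrow> lin (\<lambda>a. f (us @ [a] @ vs))"
  using cochains_slotD[of f scale R n us vs] by simp

lemma CI:
  assumes "\<And>xs. length xs \<noteq> n \<Longrightarrow> f xs = 0"
    and "\<And>us vs. length us + length vs + 1 = n \<Longrightarrow> lin (\<lambda>a. f (us @ [a] @ vs))"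
  shows "f \<in> C n"
  by (rule cochains_slotI) (use assms in auto)

lemma zero_in_C: "(\<lambda>_. 0) \<in> C n"
  by (rule CI) (simp_all add: lin_zero)

lemma add_in_C: "f \<in> C n \<Longrightarrow> g \<in> C n \<Longrightarrow> (\<lambda>xs. f xs + g xs) \<in> C n"
  by (rule CI, simp add: cochains_length) (intro lin_add C_slot)

lemma diff_in_C: "f \<in> C n \<Longrightarrow> g \<in> C n \<Longrightarrow> (\<lambda>xs. f xs - g xs) \<in> C n"
  by (rule CI, simp add: cochains_length) (intro lin_diff C_slot)

lemma scale_in_C: "f \<in> C n \<Longrightarrow> (\<lambda>xs. scale c (f xs)) \<in> C n"
  by (rule CI, simp add: cochains_length) (intro lin_scale C_slot)

lemma signed_in_C: "f \<in> C n \<Longrightarrow> (\<lambda>xs. signed k (f xs)) \<in> C n"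
  using scale_in_C[of f n "(-1) ^ k"] by (simp add: scale_sign)

lemma mult_cochain_in_C: "mult_cochain \<in> C 2"
proof (rule CI)
  fix us vs :: "'a list" assume len: "length us + length vs + 1 = 2"
  consider b where "us = []" "vs = [b]" | b where "us = [b]" "vs = []"
    using len by (cases us; cases vs) auto
  then show "lin (\<lambda>a. mult_cochain (us @ [a] @ vs))"
    by cases (simp_all add: mult_cochain_def lin_mult_left lin_mult_right lin_id)
qed (simp add: mult_cochain_def)

lemma brace_in_C:
  assumes f: "f \<in> C n" and g: "g \<in> C m"
  shows "brace n m f g \<in> C (n + m - 1)"
proof (rule CI)
  fix xs :: "'a list" assume len: "length xs \<noteq> n + m - 1"
  show "brace n m f g xs = 0"
    by (rule brace_eq_0) (use len in linarith)
next
  fix us vs :: "'a list" assume len: "length us + length vs + 1 = n + m - 1"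
  let ?t = "\<lambda>i a. f (take i (us @ [a] @ vs) @ [g (take m (drop i (us @ [a] @ vs)))] @ drop (i + m) (us @ [a] @ vs))"
  have "lin (?t i)" if i: "i < n" for i
  proof -
    \<comment> \<open>The varying entry lies to the right of the arguments of \<open>g\<close>, among them, or to the left.\<close>
    consider d where "i = length us + Suc d" | d r where "length us = i + d" "m = d + Suc r"
      | d where "length us = i + m + d"
    proof -
      consider "length us < i" | "i \<le> length us" "length us < i + m" | "i + m \<le> length us"
        by linarith
      then show thesis
      proof cases
        case 1 then show thesis using that(1) less_imp_Suc_add by fastforce
      next
        case 2
        have "length us = i + (length us - i)" "m = (length us - i) + Suc (m - Suc (length us - i))"
          using 2 by linarith+
        then show thesis by (rule that(2))
      next
        case 3 then show thesis using that(3) le_Suc_ex by blast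
      qed
    qed
    then show ?thesis
    proof cases
      case (1 d)
      then have "?t i = (\<lambda>a. f (us @ [a] @ (take d vs @ [g (take m (drop d vs))] @ drop (d + m) vs)))"
        by (simp add: add_ac)
      moreover have "length us + length (take d vs @ [g (take m (drop d vs))] @ drop (d + m) vs) + 1 = n"
        using len i 1 by auto
      ultimately show ?thesis using C_slot[OF f] by presburger
    next
      case (2 d r)
      have t: "?t i = (\<lambda>a. f (take i us @ [g (drop i us @ [a] @ take r vs)] @ drop r vs))"
        by (simp add: 2)
      have "length (take i us) + length (drop r vs) + 1 = n" "length (drop i us) + length (take r vs) + 1 = m"
        using len i 2 by auto
      then show ?thesis
        unfolding t by (intro lin_compose[OF C_slot[OF f] C_slot[OF g]])
    next
      case (3 d)
      then have "?t i = (\<lambda>a. f ((take i us @ [g (take m (drop i us))] @ drop (i + m) us) @ [a] @ vs))"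
        by simp
      moreover have "length (take i us @ [g (take m (drop i us))] @ drop (i + m) us) + length vs + 1 = n"
        using len i 3 by auto
      ultimately show ?thesis using C_slot[OF f] by presburger
    qed
  qed
  then have "lin (\<lambda>a. \<Sum>i<n. scale ((-1) ^ (i * (m + 1))) (?t i a))"
    by (intro lin_sum lin_scale) simp
  moreover have "brace n m f g (us @ [a] @ vs) = (\<Sum>i<n. scale ((-1) ^ (i * (m + 1))) (?t i a))" for a
    using len by (simp add: brace_def scale_sign)
  ultimately show "lin (\<lambda>a. brace n m f g (us @ [a] @ vs))"
    by presburger
qed

lemma cup_in_C:
  assumes f: "f \<in> C n" and g: "g \<in> C m"
  shows "cup (*) n m f g \<in> C (n + m)"
proof (rule CI)
  fix us vs :: "'a list" assume len: "length us + length vs + 1 = n + m"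
  show "lin (\<lambda>a. cup (*) n m f g (us @ [a] @ vs))"
  proof (cases "length us < n")
    case True
    then obtain d where d: "n = length us + Suc d" using less_imp_Suc_add by fastforce
    then have "length us + length (take d vs) + 1 = n" using len by auto
    moreover have "(\<lambda>a. cup (*) n m f g (us @ [a] @ vs)) = (\<lambda>a. f (us @ [a] @ take d vs) * g (drop d vs))"
      using len d by (auto simp: cup_def)
    ultimately show ?thesis by (simp only: lin_mult_left C_slot[OF f])
  next
    case False
    then have "length (drop n us) + length vs + 1 = m" using len by auto
    moreover have "(\<lambda>a. cup (*) n m f g (us @ [a] @ vs)) = (\<lambda>a. f (take n us) * g (drop n us @ [a] @ vs))"
      using len False by (auto simp: cup_def)
    ultimately show ?thesis by (simp only: lin_mult_right C_slot[OF g])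
  qed
qed (simp add: cup_def)

lemma circ_regular: "circ R = brace"
  by (intro ext) (simp add: circ_def brace_def scale_sign)

lemma gerstenhaber_bracket_eq: "gerstenhaber_bracket scale = brace_bracket"
  by (intro ext) (simp only: gerstenhaber_bracket_def brace_bracket_def circ_regular scale_sign)

lemma bracket_in_C:
  assumes "f \<in> C n" "g \<in> C m"
  shows "brace_bracket n m f g \<in> C (n + m - 1)"
  using diff_in_C[OF brace_in_C[OF assms] signed_in_C[OF brace_in_C[OF assms(2,1), unfolded add.commute[of m n]]]]
  by (simp add: brace_bracket_def[abs_def])

abbreviation \<delta> :: "nat \<Rightarrow> ('a list \<Rightarrow> 'a) \<Rightarrow> 'a list \<Rightarrow> 'a" where
  "\<delta> \<equiv> hochschild_diff R"

lemma \<delta>_eq: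
  "\<delta> n f xs = (if length xs = Suc n then hd xs * f (tl xs)
     + (\<Sum>i<n. signed (i + 1) (f (take i xs @ [xs ! i * xs ! (i + 1)] @ drop (i + 2) xs)))
     + signed (n + 1) (f (butlast xs) * last xs) else 0)"
  by (simp add: hochschild_diff_def sum.atLeast1_atMost_eq scale_sign del: power_Suc)

lemma \<delta>_add: "\<delta> n (\<lambda>xs. f xs + g xs) = (\<lambda>xs. \<delta> n f xs + \<delta> n g xs)"
  by (rule ext) (simp add: \<delta>_eq signed_plus sum.distrib algebra_simps)

lemma \<delta>_scale: "\<delta> n (\<lambda>xs. scale c (f xs)) = (\<lambda>xs. scale c (\<delta> n f xs))"
  by (rule ext) (simp add: \<delta>_eq scale_sign[symmetric] scale_mult_left scale_mult_right scale_sum_right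
      scale_right_distrib mult.commute del: power_Suc)

text \<open>
  The insertions of \<open>f\<close> into the two slots of \<open>\<mu>\<close> are the outer terms of the differential, and the insertions of
  \<open>\<mu>\<close> into \<open>f\<close> are its inner terms.
\<close>

lemma \<delta>_eq_bracket:
  assumes "f \<in> C n"
  shows "\<delta> n f xs = - brace_bracket n 2 f mult_cochain xs"
proof (cases "length xs = Suc n")
  case True
  have inner: "(\<Sum>i<n. signed (i + 1) (f (take i xs @ [xs ! i * xs ! (i + 1)] @ drop (i + 2) xs)))
      = - brace n 2 f mult_cochain xs"
    using True
    by (auto simp: brace_def mult_cochain_def signed_def sum_negf[symmetric] intro!: sum.cong)
  have outer: "brace 2 n mult_cochain f xs = f (butlast xs) * last xs + signed (n + 1) (hd xs * f (tl xs))"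
    using True
    by (cases xs rule: rev_cases; cases xs)
      (auto simp: brace_def mult_cochain_def numeral_2_eq_2 signed_def last_conv_nth hd_conv_nth nth_append drop_Suc)
  show ?thesis
    unfolding \<delta>_eq inner brace_bracket_def outer using True
    by (cases "even n") (simp_all add: signed_def)
qed (simp add: \<delta>_eq brace_bracket_def brace_def)

text \<open>
  The Jacobi identity with \<open>\<mu>\<close> as third entry.
\<close>

lemma \<delta>_bracket:
  assumes f: "f \<in> C n" and g: "g \<in> C m"
  shows "\<delta> (n + m - 1) (brace_bracket n m f g) xs =
    brace_bracket n (m + 1) f (\<delta> m g) xs + signed (m + 1) (brace_bracket (n + 1) m (\<delta> n f) g xs)"
proof -
  note add = cochains_additive[OF f] cochains_additive[OF g] cochains_additive[OF mult_cochain_in_C]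
  have df: "\<delta> n f = (\<lambda>xs. - brace_bracket n 2 f mult_cochain xs)"
    and dg: "\<delta> m g = (\<lambda>xs. - brace_bracket m 2 g mult_cochain xs)"
    using \<delta>_eq_bracket f g by auto
  have "brace_bracket n (m + 1) f (\<delta> m g) xs = - brace_bracket n (m + 1) f (brace_bracket m 2 g mult_cochain) xs"
    unfolding dg brace_bracket_def[of n "m + 1"] brace_uminus_left brace_uminus_right[OF add(1)]
    by (cases "even n"; cases "even m") (simp_all add: signed_def)
  moreover have "brace_bracket (n + 1) m (\<delta> n f) g xs = - brace_bracket (n + 1) m (brace_bracket n 2 f mult_cochain) g xs"
    unfolding df brace_bracket_def[of "n + 1" m] brace_uminus_left brace_uminus_right[OF add(2)]
    by (cases "even n"; cases "even m") (simp_all add: signed_def)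
  ultimately show ?thesis
    using brace_bracket_jacobi[OF add, of xs] \<delta>_eq_bracket[OF bracket_in_C[OF f g], of xs]
    by (cases "even m") (simp_all add: signed_def)
qed

text \<open>
  Split the inner terms of the differential at position \<open>n\<close>.  The right outer term of \<open>\<delta>f\<close> and the left outer term
  of \<open>\<delta>g\<close>, which both multiply by the entry \<open>xs ! n\<close>, cancel.
\<close>

lemma \<delta>_cup:
  "\<delta> (n + m) (cup (*) n m f g) xs =
    cup (*) (n + 1) m (\<delta> n f) g xs + signed n (cup (*) n (m + 1) f (\<delta> m g) xs)"
proof (cases "length xs = n + m + 1")
  case True
  \<comment> \<open>The arguments of \<open>\<delta>f\<close> and of \<open>\<delta>g\<close> overlap in the entry \<open>xs ! n\<close>.\<close>
  define y z where "y = take (n + 1) xs" and "z = drop n xs"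
  have n: "n < length xs" using True by simp
  have ly: "length y = n + 1" and lz: "length z = m + 1" using True by (auto simp: y_def z_def)
  have mid: "last y = hd z" using n by (simp add: y_def z_def take_Suc_conv_app_nth hd_drop_conv_nth)
  have buty: "butlast y = take n xs" using n by (simp add: y_def butlast_take)
  have tz: "tl z = drop (n + 1) xs" by (simp add: z_def drop_Suc tl_drop)
  let ?F = "\<lambda>i. f (take i y @ [y ! i * y ! (i + 1)] @ drop (i + 2) y)"
  let ?G = "\<lambda>i. g (take i z @ [z ! i * z ! (i + 1)] @ drop (i + 2) z)"
  let ?c = "\<lambda>i. cup (*) n m f g (take i xs @ [xs ! i * xs ! (i + 1)] @ drop (i + 2) xs)"
  have c1: "?c i = ?F i * g (tl z)" if "i < n" for i
  proof -
    obtain d where d: "n = i + Suc d" using less_imp_Suc_add[OF \<open>i < n\<close>] by auto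
    have "length (take i xs @ [xs ! i * xs ! (i + 1)] @ drop (i + 2) xs) = n + m"
      using that True by auto
    moreover have "take n (take i xs @ [xs ! i * xs ! (i + 1)] @ drop (i + 2) xs)
        = take i y @ [y ! i * y ! (i + 1)] @ drop (i + 2) y"
      using that True by (simp add: y_def d drop_take)
    moreover have "drop n (take i xs @ [xs ! i * xs ! (i + 1)] @ drop (i + 2) xs) = tl z"
      using that True by (simp add: tz d add_ac)
    ultimately show ?thesis by (simp only: cup_def simp_thms if_True)
  qed
  have c2: "?c (n + i) = f (butlast y) * ?G i" if "i < m" for i
  proof -
    have "take (n + i) xs = take n xs @ take i z" by (simp add: take_add z_def)
    moreover have "xs ! (n + i) = z ! i" "xs ! (n + i + 1) = z ! (i + 1)"
      using n by (simp_all add: z_def)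
    moreover have "drop (n + i + 2) xs = drop (i + 2) z" by (simp add: z_def add_ac)
    ultimately show ?thesis
      using that True lz by (simp add: cup_def buty)
  qed
  have "(\<Sum>i<n+m. signed (i + 1) (?c i)) = (\<Sum>i<n. signed (i + 1) (?c i)) + (\<Sum>i<m. signed (n + i + 1) (?c (n + i)))"
    using sum.atLeastLessThan_concat[of 0 n "n + m" "\<lambda>i. signed (i + 1) (?c i)"]
      sum.shift_bounds_nat_ivl[of "\<lambda>i. signed (i + 1) (?c i)" 0 n m]
    by (simp add: lessThan_atLeast0 add.commute)
  also have "\<dots> = (\<Sum>i<n. signed (i + 1) (?F i)) * g (tl z) + signed n (f (butlast y) * (\<Sum>i<m. signed (i + 1) (?G i)))"
  proof (rule arg_cong2[where f="(+)"])
    show "(\<Sum>i<n. signed (i + 1) (?c i)) = (\<Sum>i<n. signed (i + 1) (?F i)) * g (tl z)"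
      unfolding sum_distrib_right by (intro sum.cong refl) (simp only: lessThan_iff c1 signed_def, simp)
    show "(\<Sum>i<m. signed (n + i + 1) (?c (n + i))) = signed n (f (butlast y) * (\<Sum>i<m. signed (i + 1) (?G i)))"
      unfolding sum_distrib_left signed_sum
      by (intro sum.cong refl) (simp only: lessThan_iff c2 signed_def, simp)
  qed
  finally have sums: "(\<Sum>i<n+m. signed (i + 1) (?c i)) =
     (\<Sum>i<n. signed (i + 1) (?F i)) * g (tl z) + signed n (f (butlast y) * (\<Sum>i<m. signed (i + 1) (?G i)))" .
  have first: "hd xs * cup (*) n m f g (tl xs) = hd y * f (tl y) * g (tl z)"
    using True n by (cases xs) (simp_all add: cup_def y_def z_def drop_Suc tl_drop mult.assoc)
  have last: "cup (*) n m f g (butlast xs) * last xs = f (butlast y) * (g (butlast z) * last z)"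
    using True n by (simp add: cup_def buty z_def mult.assoc take_butlast drop_butlast)
  have "\<delta> (n + m) (cup (*) n m f g) xs = hd y * f (tl y) * g (tl z) +
     ((\<Sum>i<n. signed (i + 1) (?F i)) * g (tl z) + signed n (f (butlast y) * (\<Sum>i<m. signed (i + 1) (?G i))))
     + signed (n + m + 1) (f (butlast y) * (g (butlast z) * last z))"
    unfolding \<delta>_eq sums first last using True by simp
  also have "\<dots> = \<delta> n f y * g (tl z) + signed n (f (butlast y) * \<delta> m g z)"
    using ly lz mid unfolding \<delta>_eq by (auto simp: signed_def algebra_simps)
  also have "\<dots> = cup (*) (n + 1) m (\<delta> n f) g xs + signed n (cup (*) n (m + 1) f (\<delta> m g) xs)"
    using True by (simp add: cup_def y_def z_def buty[unfolded y_def] tz[unfolded z_def] butlast_take)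
  finally show ?thesis .
qed (simp add: cup_def \<delta>_eq)

end

section \<open>Product and bracket on cohomology\<close>

lemma quotient_induced1:
  assumes "equiv A r" "equiv B s"
    and "\<And>f. f \<in> A \<Longrightarrow> op f \<in> B"
    and "\<And>f f'. (f, f') \<in> r \<Longrightarrow> (op f, op f') \<in> s"
    and "X \<in> A // r"
  shows "induced1 s op X \<in> B // s"
proof -
  obtain f where f: "f \<in> A" "X = r `` {f}" using assms(5) by (rule quotientE)
  have "(\<lambda>f. s `` {op f}) respects r"
    unfolding congruent_def using assms(4) equiv_class_eq[OF assms(2)] by blast
  from UN_equiv_class[OF assms(1) this f(1)] have "induced1 s op X = s `` {op f}"
    by (simp add: induced1_def f(2))
  then show ?thesis using assms(3)[OF f(1)] by (simp add: quotientI)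
qed

lemma quotient_induced2:
  assumes "equiv A r" "equiv A' r'" "equiv B s"
    and "\<And>f g. f \<in> A \<Longrightarrow> g \<in> A' \<Longrightarrow> op f g \<in> B"
    and "\<And>f f' g. (f, f') \<in> r \<Longrightarrow> g \<in> A' \<Longrightarrow> (op f g, op f' g) \<in> s"
    and "\<And>f g g'. f \<in> A \<Longrightarrow> (g, g') \<in> r' \<Longrightarrow> (op f g, op f g') \<in> s"
    and "X \<in> A // r" "Y \<in> A' // r'"
  shows "induced2 s op X Y \<in> B // s"
proof -
  obtain f where f: "f \<in> A" "X = r `` {f}" using assms(7) by (rule quotientE)
  obtain g where g: "g \<in> A'" "Y = r' `` {g}" using assms(8) by (rule quotientE)
  have "congruent2 r r' (\<lambda>f g. s `` {op f g})"
    by (rule congruent2I[OF assms(1,2)]) (use assms(5,6) equiv_class_eq[OF assms(3)] in blast)+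
  from UN_equiv_class2[OF assms(1,2) this f(1) g(1)] have "induced2 s op X Y = s `` {op f g}"
    by (simp add: induced2_def f(2) g(2))
  then show ?thesis using assms(4)[OF f(1) g(1)] by (simp add: quotientI)
qed

context k_algebra
begin

abbreviation cocyc :: "nat \<Rightarrow> ('a list \<Rightarrow> 'a) set" where "cocyc \<equiv> cocycles scale R"
abbreviation cobd :: "nat \<Rightarrow> ('a list \<Rightarrow> 'a) set" where "cobd \<equiv> coboundaries scale R"
abbreviation cohom :: "nat \<Rightarrow> ('a list \<Rightarrow> 'a) rel" where "cohom \<equiv> cohomologous scale R"

lemma cocyc_iff: "f \<in> cocyc n \<longleftrightarrow> f \<in> C n \<and> (\<forall>xs. \<delta> n f xs = 0)"
  by (auto simp: cocycles_def fun_eq_iff)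

lemma cobd_Suc_iff: "f \<in> cobd (Suc n) \<longleftrightarrow> (\<exists>u\<in>C n. f = \<delta> n u)"
  by (auto simp: coboundaries_def)

lemma cobd_0_iff: "f \<in> cobd 0 \<longleftrightarrow> f = (\<lambda>_. 0)"
  by (simp add: coboundaries_def zero_fun_def)

lemma \<delta>_zero: "\<delta> n (\<lambda>_. 0) = (\<lambda>_. 0)"
  by (rule ext) (simp add: \<delta>_eq)

lemma zero_in_cobd: "(\<lambda>_. 0) \<in> cobd n"
  by (cases n) (auto simp: cobd_0_iff cobd_Suc_iff \<delta>_zero intro!: bexI[OF _ zero_in_C])

lemma add_in_cobd:
  assumes "f \<in> cobd n" "g \<in> cobd n" shows "(\<lambda>xs. f xs + g xs) \<in> cobd n"
proof (cases n)
  case (Suc m)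
  then obtain u v where "u \<in> C m" "v \<in> C m" "f = \<delta> m u" "g = \<delta> m v"
    using assms by (auto simp: cobd_Suc_iff)
  then show ?thesis
    unfolding Suc cobd_Suc_iff by (intro bexI[of _ "\<lambda>xs. u xs + v xs"]) (simp_all add: \<delta>_add add_in_C)
qed (use assms in \<open>simp add: cobd_0_iff\<close>)

lemma scale_in_cobd:
  assumes "f \<in> cobd n" shows "(\<lambda>xs. scale c (f xs)) \<in> cobd n"
proof (cases n)
  case (Suc m)
  then obtain u where "u \<in> C m" "f = \<delta> m u"
    using assms by (auto simp: cobd_Suc_iff)
  then show ?thesis
    unfolding Suc cobd_Suc_iff by (intro bexI[of _ "\<lambda>xs. scale c (u xs)"]) (simp_all add: \<delta>_scale scale_in_C)
qed (use assms in \<open>simp add: cobd_0_iff\<close>)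

lemma signed_in_cobd: "f \<in> cobd n \<Longrightarrow> (\<lambda>xs. signed k (f xs)) \<in> cobd n"
  using scale_in_cobd[of f n "(-1) ^ k"] by (simp add: scale_sign)

lemma signed_in_cobd_iff: "(\<lambda>xs. signed k (f xs)) \<in> cobd n \<longleftrightarrow> f \<in> cobd n"
proof -
  have "(\<lambda>xs. signed k (signed k (f xs))) = f" by (cases "even k") (simp_all add: signed_def)
  then show ?thesis using signed_in_cobd[of f n k] signed_in_cobd[of "\<lambda>xs. signed k (f xs)" n k] by auto
qed

lemma cohom_iff: "(f, g) \<in> cohom n \<longleftrightarrow> f \<in> cocyc n \<and> g \<in> cocyc n \<and> (\<lambda>xs. f xs - g xs) \<in> cobd n"
  by (auto simp: cohomologous_def fun_diff_def)

text \<open>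
  Cohomologous means having a difference in a linear subspace.
\<close>

lemma equiv_cohom: "equiv (cocyc n) (cohom n)"
proof (rule equivI)
  show "cohom n \<subseteq> cocyc n \<times> cocyc n" by (auto simp: cohom_iff)
  show "refl_on (cocyc n) (cohom n)"
    by (auto simp: refl_on_def cohom_iff zero_in_cobd)
  show "sym (cohom n)"
  proof (rule symI)
    fix f g assume "(f, g) \<in> cohom n"
    then show "(g, f) \<in> cohom n"
      using signed_in_cobd[of "\<lambda>xs. f xs - g xs" n 1] by (simp add: cohom_iff signed_def)
  qed
  show "trans (cohom n)"
  proof (rule transI)
    fix f g h assume "(f, g) \<in> cohom n" "(g, h) \<in> cohom n"
    then show "(f, h) \<in> cohom n"
      using add_in_cobd[of "\<lambda>xs. f xs - g xs" n "\<lambda>xs. g xs - h xs"] by (simp add: cohom_iff)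
  qed
qed

lemma bilinear_op_on_cohomology:
  assumes closed: "\<And>f g. f \<in> cocyc n \<Longrightarrow> g \<in> cocyc m \<Longrightarrow> op f g \<in> cocyc p"
    and diff_left: "\<And>f f' g xs. f \<in> cocyc n \<Longrightarrow> f' \<in> cocyc n \<Longrightarrow> g \<in> cocyc m \<Longrightarrow>
      op (\<lambda>xs. f xs - f' xs) g xs = op f g xs - op f' g xs"
    and diff_right: "\<And>f g g' xs. f \<in> cocyc n \<Longrightarrow> g \<in> cocyc m \<Longrightarrow> g' \<in> cocyc m \<Longrightarrow>
      op f (\<lambda>xs. g xs - g' xs) xs = op f g xs - op f g' xs"
    and cobd_left: "\<And>f g. f \<in> cobd n \<Longrightarrow> g \<in> cocyc m \<Longrightarrow> op f g \<in> cobd p"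
    and cobd_right: "\<And>f g. f \<in> cocyc n \<Longrightarrow> g \<in> cobd m \<Longrightarrow> op f g \<in> cobd p"
    and "X \<in> hochschild_cohomology scale R n" "Y \<in> hochschild_cohomology scale R m"
  shows "induced2 (cohom p) op X Y \<in> hochschild_cohomology scale R p"
  unfolding hochschild_cohomology_def
proof (rule quotient_induced2[OF equiv_cohom equiv_cohom equiv_cohom closed])
  fix f f' g assume "(f, f') \<in> cohom n" and g: "g \<in> cocyc m"
  then have f: "f \<in> cocyc n" "f' \<in> cocyc n" "(\<lambda>xs. f xs - f' xs) \<in> cobd n"
    by (auto simp: cohom_iff)
  have "op (\<lambda>xs. f xs - f' xs) g = (\<lambda>xs. op f g xs - op f' g xs)"
    using diff_left[OF f(1,2) g] by (rule ext)
  then show "(op f g, op f' g) \<in> cohom p"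
    using cobd_left[OF f(3) g] closed f g by (simp add: cohom_iff)
next
  fix f g g' assume f: "f \<in> cocyc n" and "(g, g') \<in> cohom m"
  then have g: "g \<in> cocyc m" "g' \<in> cocyc m" "(\<lambda>xs. g xs - g' xs) \<in> cobd m"
    by (auto simp: cohom_iff)
  have "op f (\<lambda>xs. g xs - g' xs) = (\<lambda>xs. op f g xs - op f g' xs)"
    using diff_right[OF f g(1,2)] by (rule ext)
  then show "(op f g, op f g') \<in> cohom p"
    using cobd_right[OF f g(3)] closed f g by (simp add: cohom_iff)
qed (use assms(6,7) in \<open>auto simp: hochschild_cohomology_def\<close>)

lemma cup_zero: "cup (*) n m (\<lambda>_. 0) g = (\<lambda>_. (0::'a))" "cup (*) n m g (\<lambda>_. 0) = (\<lambda>_. (0::'a))"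
  by (auto simp: cup_def)

lemma cup_on_cohomology:
  assumes "X \<in> hochschild_cohomology scale R n" "Y \<in> hochschild_cohomology scale R m"
  shows "induced2 (cohom (n + m)) (cup (*) n m) X Y \<in> hochschild_cohomology scale R (n + m)"
proof (rule bilinear_op_on_cohomology[OF _ _ _ _ _ assms])
  fix f g :: "'a list \<Rightarrow> 'a" assume f: "f \<in> cocyc n" and g: "g \<in> cocyc m"
  have "\<delta> n f = (\<lambda>_. 0)" "\<delta> m g = (\<lambda>_. 0)" using f g by (auto simp: cocyc_iff)
  then show "cup (*) n m f g \<in> cocyc (n + m)"
    using f g by (simp add: cocyc_iff cup_in_C \<delta>_cup cup_zero)
next
  fix f g :: "'a list \<Rightarrow> 'a" assume f: "f \<in> cobd n" and g: "g \<in> cocyc m"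
  show "cup (*) n m f g \<in> cobd (n + m)"
  proof (cases n)
    case (Suc k)
    then obtain u where u: "u \<in> C k" "f = \<delta> k u" using f by (auto simp: cobd_Suc_iff)
    have g': "g \<in> C m" "\<delta> m g = (\<lambda>_. 0)" using g by (auto simp: cocyc_iff)
    have "cup (*) n m f g = \<delta> (k + m) (cup (*) k m u g)"
      using \<delta>_cup[of k m u g] by (simp add: fun_eq_iff g' u Suc cup_zero)
    then show ?thesis using cup_in_C[OF u(1) g'(1)] by (auto simp: Suc cobd_Suc_iff)
  qed (use f in \<open>simp add: cobd_0_iff cup_zero zero_in_cobd\<close>)
next
  fix f g :: "'a list \<Rightarrow> 'a" assume f: "f \<in> cocyc n" and g: "g \<in> cobd m"
  show "cup (*) n m f g \<in> cobd (n + m)"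
  proof (cases m)
    case (Suc k)
    then obtain v where v: "v \<in> C k" "g = \<delta> k v" using g by (auto simp: cobd_Suc_iff)
    have f': "f \<in> C n" "\<delta> n f = (\<lambda>_. 0)" using f by (auto simp: cocyc_iff)
    have "(\<lambda>xs. signed n (cup (*) n m f g xs)) = \<delta> (n + k) (cup (*) n k f v)"
      using \<delta>_cup[of n k f v] by (simp add: fun_eq_iff f' v Suc cup_zero)
    then have "(\<lambda>xs. signed n (cup (*) n m f g xs)) \<in> cobd (n + m)"
      using cup_in_C[OF f'(1) v(1)] by (auto simp: Suc cobd_Suc_iff)
    then show ?thesis by (simp only: signed_in_cobd_iff)
  qed (use g in \<open>simp add: cobd_0_iff cup_zero zero_in_cobd\<close>)
qed (auto simp: cup_def algebra_simps)

lemma brace_zero_right: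
  assumes "f \<in> C n" shows "brace n m f (\<lambda>_. 0) = (\<lambda>_. 0)"
  using brace_diff_right[OF cochains_additive[OF assms], of m "\<lambda>_. 0" 0 "\<lambda>_. 0"]
  by (simp add: signed_def fun_eq_iff)

lemma bracket_zero_right: "f \<in> C n \<Longrightarrow> brace_bracket n m f (\<lambda>_. 0) = (\<lambda>_. 0)"
  by (simp add: brace_bracket_def fun_eq_iff brace_zero_right)

lemma bracket_zero_left: "g \<in> C m \<Longrightarrow> brace_bracket n m (\<lambda>_. 0) g = (\<lambda>_. 0)"
  by (simp add: brace_bracket_def fun_eq_iff brace_zero_right)

text \<open>
  If \<open>g\<close> is a cocycle, then \<open>\<plusminus>[\<delta>u, g] = \<delta>[u, g]\<close>, and similarly on the other side.  When \<open>u\<close> and \<open>g\<close> both have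
  degree \<open>0\<close>, their bracket is \<open>0\<close>, and the identity says that \<open>[\<delta>u, g]\<close> is the zero of degree \<open>0\<close>, the only
  coboundary there.
\<close>

lemma bracket_on_cohomology:
  assumes "X \<in> hochschild_cohomology scale R n" "Y \<in> hochschild_cohomology scale R m"
  shows "induced2 (cohom (n + m - 1)) (brace_bracket n m) X Y \<in> hochschild_cohomology scale R (n + m - 1)"
proof (rule bilinear_op_on_cohomology[OF _ _ _ _ _ assms])
  fix f g :: "'a list \<Rightarrow> 'a" assume f: "f \<in> cocyc n" and g: "g \<in> cocyc m"
  have "\<delta> n f = (\<lambda>_. 0)" "\<delta> m g = (\<lambda>_. 0)" "f \<in> C n" "g \<in> C m" using f g by (auto simp: cocyc_iff)
  then show "brace_bracket n m f g \<in> cocyc (n + m - 1)"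
    using \<delta>_bracket[of f n g m] bracket_zero_left[of g] bracket_zero_right[of f]
      bracket_in_C[of f n g m]
    by (simp add: cocyc_iff)
next
  fix f f' g :: "'a list \<Rightarrow> 'a" and xs assume "f \<in> cocyc n" "f' \<in> cocyc n" "g \<in> cocyc m"
  then have "slotwise_additive m g" by (auto simp: cocyc_iff intro: cochains_additive)
  then show "brace_bracket n m (\<lambda>xs. f xs - f' xs) g xs = brace_bracket n m f g xs - brace_bracket n m f' g xs"
    using brace_diff_left[of n m f 0 f' g xs] brace_diff_right[of m g n f 0 f' xs]
    by (cases "even n"; cases "even m") (simp_all add: brace_bracket_def signed_def)
next
  fix f g g' :: "'a list \<Rightarrow> 'a" and xs assume "f \<in> cocyc n" "g \<in> cocyc m" "g' \<in> cocyc m"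
  then have "slotwise_additive n f" by (auto simp: cocyc_iff intro: cochains_additive)
  then show "brace_bracket n m f (\<lambda>xs. g xs - g' xs) xs = brace_bracket n m f g xs - brace_bracket n m f g' xs"
    using brace_diff_left[of m n g 0 g' f xs] brace_diff_right[of n f m g 0 g' xs]
    by (cases "even n"; cases "even m") (simp_all add: brace_bracket_def signed_def)
next
  fix f g :: "'a list \<Rightarrow> 'a" assume f: "f \<in> cobd n" and g: "g \<in> cocyc m"
  show "brace_bracket n m f g \<in> cobd (n + m - 1)"
  proof (cases n)
    case (Suc k)
    then obtain u where u: "u \<in> C k" "f = \<delta> k u" using f by (auto simp: cobd_Suc_iff)
    have g': "g \<in> C m" "\<delta> m g = (\<lambda>_. 0)" using g by (auto simp: cocyc_iff)
    have eq: "(\<lambda>xs. signed (m + 1) (brace_bracket n m f g xs)) = \<delta> (k + m - 1) (brace_bracket k m u g)"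
      using \<delta>_bracket[OF u(1) g'(1)] bracket_zero_right[OF u(1)] by (simp add: fun_eq_iff g' u Suc)
    have "(\<lambda>xs. signed (m + 1) (brace_bracket n m f g xs)) \<in> cobd (k + m)"
    proof (cases "k + m")
      case 0
      then have "brace_bracket k m u g = (\<lambda>_. 0)" by (simp add: brace_bracket_def fun_eq_iff)
      then show ?thesis unfolding eq by (simp add: \<delta>_zero zero_in_cobd)
    next
      case (Suc l)
      then show ?thesis
        unfolding eq using bracket_in_C[OF u(1) g'(1)] by (auto simp: cobd_Suc_iff)
    qed
    then show ?thesis by (simp only: signed_in_cobd_iff) (simp add: Suc)
  next
    case 0
    then show ?thesis using f g bracket_zero_left by (simp add: cobd_0_iff cocyc_iff zero_in_cobd)
  qed
next
  fix f g :: "'a list \<Rightarrow> 'a" assume f: "f \<in> cocyc n" and g: "g \<in> cobd m"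
  show "brace_bracket n m f g \<in> cobd (n + m - 1)"
  proof (cases m)
    case (Suc k)
    then obtain v where v: "v \<in> C k" "g = \<delta> k v" using g by (auto simp: cobd_Suc_iff)
    have f': "f \<in> C n" "\<delta> n f = (\<lambda>_. 0)" using f by (auto simp: cocyc_iff)
    have eq: "brace_bracket n m f g = \<delta> (n + k - 1) (brace_bracket n k f v)"
      using \<delta>_bracket[OF f'(1) v(1)] bracket_zero_left[OF v(1)] by (simp add: fun_eq_iff f' v Suc)
    have "brace_bracket n m f g \<in> cobd (n + k)"
    proof (cases "n + k")
      case 0
      then have "brace_bracket n k f v = (\<lambda>_. 0)" by (simp add: brace_bracket_def fun_eq_iff)
      then show ?thesis unfolding eq by (simp add: \<delta>_zero zero_in_cobd)
    next
      case (Suc l)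
      then show ?thesis
        unfolding eq using bracket_in_C[OF f'(1) v(1)] by (auto simp: cobd_Suc_iff)
    qed
    then show ?thesis by (simp add: Suc)
  next
    case 0
    then show ?thesis using f g bracket_zero_right by (simp add: cobd_0_iff cocyc_iff zero_in_cobd)
  qed
qed

lemma add_on_cohomology:
  assumes "X \<in> hochschild_cohomology scale R n" "Y \<in> hochschild_cohomology scale R n"
  shows "induced2 (cohom n) (+) X Y \<in> hochschild_cohomology scale R n"
proof -
  have add: "f + g \<in> cocyc n" if "f \<in> cocyc n" "g \<in> cocyc n" for f g
    using that by (simp add: cocyc_iff plus_fun_def add_in_C \<delta>_add)
  show ?thesis
    unfolding hochschild_cohomology_def
    by (rule quotient_induced2[OF equiv_cohom equiv_cohom equiv_cohom add])
      (use assms add in \<open>auto simp: hochschild_cohomology_def cohom_iff\<close>)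
qed

lemma scale_on_cohomology:
  assumes "X \<in> hochschild_cohomology scale R n"
  shows "induced1 (cohom n) (\<lambda>f xs. scale c (f xs)) X \<in> hochschild_cohomology scale R n"
proof -
  have scale: "(\<lambda>xs. scale c (f xs)) \<in> cocyc n" if "f \<in> cocyc n" for f
    using that by (simp add: cocyc_iff scale_in_C \<delta>_scale)
  show ?thesis
    unfolding hochschild_cohomology_def
  proof (rule quotient_induced1[OF equiv_cohom equiv_cohom scale])
    fix f f' assume "(f, f') \<in> cohom n"
    then show "(\<lambda>xs. scale c (f xs), \<lambda>xs. scale c (f' xs)) \<in> cohom n"
      using scale scale_in_cobd[of "\<lambda>xs. f xs - f' xs" n c]
      by (simp add: cohom_iff scale_right_diff_distrib)
  qed (use assms in \<open>auto simp: hochschild_cohomology_def\<close>)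
qed

end

section \<open>Connes' operator\<close>

lemma sum_periodic_shift:
  fixes u :: "nat \<Rightarrow> 'm::ab_group_add"
  assumes "\<And>i. u (i + N) = u i"
  shows "(\<Sum>i<N. u (i + j)) = (\<Sum>i<N. u i)"
proof (induction j)
  case (Suc j)
  have "(\<Sum>i<N. u (i + Suc j)) + u j = (\<Sum>i<Suc N. u (i + j))"
    by (subst sum.lessThan_Suc_shift) (simp add: add.commute)
  also have "\<dots> = (\<Sum>i<N. u (i + j)) + u j"
    using assms[of j] by (simp add: add.commute)
  finally show ?case using Suc by simp
qed simp

lemma sign_mult_eq_signed: "(-1) ^ k * x = signed k (x::'k::ring_1)"
  by (cases "even k") (simp_all add: signed_def)

lemma rotate_slot:
  "\<exists>us' vs'. length us' + length vs' = length us + length vs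
     \<and> (\<forall>a. rotate i (us @ [a] @ vs) = us' @ [a] @ vs')"
proof (induction i)
  case (Suc i)
  then obtain us' vs' where IH: "length us' + length vs' = length us + length vs"
    "\<forall>a. rotate i (us @ [a] @ vs) = us' @ [a] @ vs'" by blast
  show ?case
  proof (cases us')
    case Nil
    then show ?thesis using IH by (intro exI[of _ vs'] exI[of _ "[]"]) simp
  next
    case (Cons u us'')
    then show ?thesis using IH by (intro exI[of _ us''] exI[of _ "vs' @ [u]"]) simp
  qed
qed (intro exI[of _ us] exI[of _ vs], simp)

lemma rotate_add_length: "rotate (i + length xs) xs = rotate i xs"
  by (simp add: rotate_rotate[symmetric])

text \<open>
  The norm operator \<open>N\<close>, the sum of the signed rotations.  On lists of length \<open>l\<close> the rotation by one step has
  the sign \<open>(-1)\<^sup>l\<^sup>-\<^sup>1\<close>, written here with the exponent \<open>l + 1\<close>.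
\<close>

definition cyclic_sum :: "('a list \<Rightarrow> 'k::ab_group_add) \<Rightarrow> 'a list \<Rightarrow> 'k" where
  "cyclic_sum \<psi> ys = (\<Sum>i<length ys. signed ((length ys + 1) * i) (\<psi> (rotate i ys)))"

text \<open>
  A rotation permutes the summands: the \<open>i\<close>-th summand, with its sign, has the length of the list as a period.
\<close>

lemma cyclic_sum_rotate:
  "cyclic_sum \<psi> (rotate j ys) = signed ((length ys + 1) * j) (cyclic_sum \<psi> ys)"
proof -
  define u where "u i = signed ((length ys + 1) * i) (\<psi> (rotate i ys))" for i
  have "cyclic_sum \<psi> (rotate j ys) = (\<Sum>i<length ys. signed ((length ys + 1) * j) (u (i + j)))"
    unfolding cyclic_sum_def u_def signed_add_left[symmetric] rotate_rotate length_rotate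
    by (intro sum.cong refl signed_cong) auto
  also have "\<dots> = signed ((length ys + 1) * j) (\<Sum>i<length ys. u (i + j))"
    by (simp only: signed_sum)
  also have "(\<Sum>i<length ys. u (i + j)) = (\<Sum>i<length ys. u i)"
  proof (rule sum_periodic_shift)
    fix i
    have "even ((length ys + 1) * (i + length ys)) = even ((length ys + 1) * i)" by auto
    from signed_cong[OF this] show "u (i + length ys) = u i"
      by (simp only: u_def rotate_add_length)
  qed
  finally show ?thesis by (simp add: cyclic_sum_def u_def)
qed

lemma cyclic_sum_backwards:
  "(\<Sum>j<length ys. signed ((length ys + 1) * j) (\<psi> (rotate (length ys - j) ys))) = cyclic_sum \<psi> ys"
proof -
  define u where "u i = signed ((length ys + 1) * i) (\<psi> (rotate i ys))" for i
  have "(\<Sum>j<length ys. signed ((length ys + 1) * j) (\<psi> (rotate (length ys - j) ys)))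
      = (\<Sum>j<length ys. u (length ys - Suc j + 1))"
  proof (rule sum.cong)
    fix j assume "j \<in> {..<length ys}"
    then have "length ys - Suc j + 1 = length ys - j" by auto
    moreover have "even ((length ys + 1) * (length ys - j)) = even ((length ys + 1) * j)"
      using \<open>j \<in> _\<close> by auto
    ultimately show "signed ((length ys + 1) * j) (\<psi> (rotate (length ys - j) ys)) = u (length ys - Suc j + 1)"
      by (simp only: u_def signed_def)
  qed simp
  also have "\<dots> = (\<Sum>i<length ys. u (i + 1))"
    by (rule sum.nat_diff_reindex)
  also have "\<dots> = (\<Sum>i<length ys. u i)"
  proof (rule sum_periodic_shift)
    fix i
    have "even ((length ys + 1) * (i + length ys)) = even ((length ys + 1) * i)" by auto
    from signed_cong[OF this] show "u (i + length ys) = u i"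
      by (simp only: u_def rotate_add_length)
  qed
  finally show ?thesis by (simp add: cyclic_sum_def u_def)
qed

definition merge :: "nat \<Rightarrow> 'a::times list \<Rightarrow> 'a list" where
  "merge j zs = take j zs @ [zs ! j * zs ! (j + 1)] @ drop (j + 2) zs"

lemma length_merge: "j + 1 < length zs \<Longrightarrow> length (merge j zs) = length zs - 1"
  by (simp add: merge_def)

text \<open>
  Rotations turn every product of adjacent entries into the product of the first two.  This makes the faces of
  the Hochschild differential comparable under the cyclic action.
\<close>

lemma rotate_merge:
  assumes "j + 1 < length zs"
  shows "rotate j (merge j zs) = merge 0 (rotate j zs)"
proof -
  define us x y vs where "us = take j zs" "x = zs ! j" "y = zs ! (j + 1)" "vs = drop (j + 2) zs"
  have zs: "zs = us @ x # y # vs" and us: "length us = j"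
    using assms unfolding us_x_y_vs_def
    by (simp_all add: Cons_nth_drop_Suc)
  have "merge j zs = us @ (x * y) # vs"
    using us by (simp add: merge_def zs nth_append)
  then show ?thesis
    using us rotate_append[of us "(x * y) # vs"] rotate_append[of us "x # y # vs"]
    by (simp add: zs merge_def)
qed

abbreviation D :: "('k::field \<Rightarrow> 'a::{ring,monoid_mult} \<Rightarrow> 'a) \<Rightarrow> ('k, 'a, 'a \<Rightarrow> 'k) bimodule" where
  "D \<equiv> dual_bimodule"

lemma dual_simps [simp]:
  "mscale (D scale) c \<phi> x = c * \<phi> x" "lact (D scale) a \<phi> x = \<phi> (x * a)" "ract (D scale) \<phi> b x = \<phi> (b * x)"
  by (simp_all add: dual_bimodule_def)

lemma fun_sum_apply: "(\<Sum>i\<in>I. u i) x = (\<Sum>i\<in>I. u i x)"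
  by (induction I rule: infinite_finite_induct) auto

lemma dual_diff_eq:
  assumes "length xs = n + 1"
  shows "hochschild_diff (D scale) n F xs x0 =
    F (tl xs) (x0 * hd xs) + (\<Sum>i<n. signed (i + 1) (F (merge i xs) x0))
    + signed (n + 1) (F (butlast xs) (last xs * x0))"
  using assms
  by (simp add: hochschild_diff_def sum.atLeast1_atMost_eq fun_sum_apply merge_def
      sign_mult_eq_signed del: power_Suc)

text \<open>
  With the argument \<open>x0\<close> of the functional in front, the left outer term of the differential becomes the
  product of the first two entries, hence a face like the inner ones.
\<close>

lemma dual_diff_eq_merge:
  assumes "length xs = n + 1"
  shows "hochschild_diff (D scale) n F xs x0 =
    (\<Sum>i<n + 1. signed i (F (tl (merge i (x0 # xs))) (hd (merge i (x0 # xs)))))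
    + signed (n + 1) (F (butlast xs) (last xs * x0))"
proof -
  have "F (tl xs) (x0 * hd xs) = F (tl (merge 0 (x0 # xs))) (hd (merge 0 (x0 # xs)))"
    using assms by (cases xs) (simp_all add: merge_def)
  moreover have "F (merge i xs) x0 = F (tl (merge (Suc i) (x0 # xs))) (hd (merge (Suc i) (x0 # xs)))" for i
    by (simp add: merge_def)
  ultimately show ?thesis
    unfolding dual_diff_eq[OF assms] Suc_eq_plus1[symmetric] sum.lessThan_Suc_shift
    by (simp add: signed_def)
qed

lemma connes_B_eq:
  assumes "length xs = n"
  shows "connes_B n F xs x0 = cyclic_sum (\<lambda>zs. F zs 1) (x0 # xs)"
proof -
  have "connes_B n F xs x0 = (\<Sum>i<n+1. (-1) ^ (n * i) * F (rotate i (x0 # xs)) 1)"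
    using assms by (simp add: connes_B_def atLeast0AtMost lessThan_Suc_atMost del: sum.lessThan_Suc)
  also have "\<dots> = (\<Sum>i<n+1. signed ((n + 1 + 1) * i) (F (rotate i (x0 # xs)) 1))"
    unfolding sign_mult_eq_signed by (intro sum.cong refl signed_cong) auto
  also have "\<dots> = cyclic_sum (\<lambda>zs. F zs 1) (x0 # xs)"
    unfolding cyclic_sum_def using assms by simp
  finally show ?thesis .
qed

text \<open>
  Both sides equal the signed sum \<open>E\<close>, over all \<open>k\<close>, of the cyclic sum of \<open>zs \<mapsto> F zs 1\<close> at the list that starts with the product of the
  cyclically adjacent entries \<open>k\<close> and \<open>k + 1\<close>.  On the left this is the invariance of cyclic sums under rotation.
  On the right, the inner face \<open>j\<close> of the rotation by \<open>i\<close> contributes to \<open>k = i + j\<close> modulo the length, and the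
  two faces that multiply by the inserted unit leave rotations of the original list, which cancel in the sum
  over all \<open>i\<close>.
\<close>

lemma connes_B_anticommutes:
  assumes len: "length xs = n + 1"
  shows "hochschild_diff (D scale) n (connes_B n F) xs x0 =
    - connes_B (n + 1) (hochschild_diff (D scale) (n + 1) F) xs x0"
proof -
  define ys where "ys = x0 # xs"
  have ly: "length ys = n + 2" using len by (simp add: ys_def)
  define \<psi> where "\<psi> = (\<lambda>zs. F zs 1)"
  define E where "E = (\<Sum>k<n+2. signed ((n + 1) * k) (cyclic_sum \<psi> (merge 0 (rotate k ys))))"
  have B: "connes_B n F (tl zs) (hd zs) = cyclic_sum \<psi> zs" if "length zs = n + 1" for zs
    using that connes_B_eq[of "tl zs" n F "hd zs"] by (cases zs) (simp_all add: \<psi>_def)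
  have "hochschild_diff (D scale) n (connes_B n F) xs x0 = E"
  proof -
    have inner: "signed ((n + 1) * k) (cyclic_sum \<psi> (merge 0 (rotate k ys)))
        = signed k (connes_B n F (tl (merge k ys)) (hd (merge k ys)))" if "k < n + 1" for k
    proof -
      have l: "length (merge k ys) = n + 1" using that ly by (simp add: length_merge)
      have "merge 0 (rotate k ys) = rotate k (merge k ys)"
        using that ly by (simp add: rotate_merge)
      then show ?thesis
        unfolding B[OF l] by (simp add: cyclic_sum_rotate l) (simp add: signed_def)
    qed
    obtain zs z where xs: "xs = zs @ [z]" using len by (cases xs rule: rev_cases) auto
    have "rotate (n + 1) ys = z # x0 # zs"
      using rotate_append[of "x0 # zs" "[z]"] len by (simp add: ys_def xs del: rotate_Suc)
    then have "merge 0 (rotate (n + 1) ys) = last xs * x0 # butlast xs"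
      by (simp add: merge_def xs)
    then have outer: "signed ((n + 1) * (n + 1)) (cyclic_sum \<psi> (merge 0 (rotate (n + 1) ys)))
        = signed (n + 1) (connes_B n F (butlast xs) (last xs * x0))"
      using B[of "last xs * x0 # butlast xs"] len by (simp add: signed_def)
    have "E = (\<Sum>k<n+1. signed ((n + 1) * k) (cyclic_sum \<psi> (merge 0 (rotate k ys))))
       + signed ((n + 1) * (n + 1)) (cyclic_sum \<psi> (merge 0 (rotate (n + 1) ys)))"
      unfolding E_def by (simp add: numeral_2_eq_2 del: rotate_Suc)
    also have "\<dots> = hochschild_diff (D scale) n (connes_B n F) xs x0"
      unfolding dual_diff_eq_merge[OF len] outer ys_def[symmetric]
      by (intro arg_cong2[where f="(+)"] sum.cong refl inner) simp
    finally show ?thesis by simp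
  qed
  moreover have "connes_B (n + 1) (hochschild_diff (D scale) (n + 1) F) xs x0 = - E"
  proof -
    \<comment> \<open>\<open>u\<close> collects the faces that multiply by the unit and \<open>v j\<close> the \<open>j\<close>-th inner faces; both have period \<open>n + 2\<close>.\<close>
    define u where "u i = signed ((n + 1) * i) (F (tl (rotate i ys)) (hd (rotate i ys)))" for i
    define v where "v j k = signed ((n + 1) * k) (\<psi> (rotate (n + 1 - j) (merge 0 (rotate k ys))))" for j k
    have period: "rotate (i + (n + 2)) ys = rotate i ys" for i
      using rotate_add_length[of i ys] ly by simp
    have parity: "even ((n + 1) * (i + (n + 2))) = even ((n + 1) * i)" for i
      by auto
    have summand: "signed ((n + 1) * i) (hochschild_diff (D scale) (n + 1) F (rotate i ys) 1)
        = u i - u (i + (n + 1)) - (\<Sum>j<n+1. signed (n * j) (v j (i + j)))" for i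
    proof -
      let ?zs = "rotate i ys"
      have lz: "length ?zs = n + 1 + 1" using ly by simp
      have "rotate (n + 1) ?zs = last ?zs # butlast ?zs"
        using rotate_append[of "butlast ?zs" "[last ?zs]"] lz
        by (metis append_butlast_last_id append_Cons append_Nil diff_add_inverse2 length_butlast
           length_greater_0_conv zero_less_Suc Suc_eq_plus1)
      then have "rotate (i + (n + 1)) ys = last ?zs # butlast ?zs"
        by (simp add: rotate_rotate add.commute del: rotate_Suc)
      then have u2: "u (i + (n + 1)) = signed ((n + 1) * (i + (n + 1))) (F (butlast ?zs) (last ?zs))"
        by (simp add: u_def)
      have v2: "signed (n * j) (v j (i + j)) = - signed ((n + 1) * i) (signed (j + 1) (F (merge j ?zs) 1))"
        if "j < n + 1" for j
      proof -
        have l: "length (merge j ?zs) = n + 1" using that lz by (simp add: length_merge)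
        have "merge 0 (rotate (i + j) ys) = rotate j (merge j ?zs)"
          using that lz by (simp add: rotate_merge rotate_rotate add.commute)
        then have "rotate (n + 1 - j) (merge 0 (rotate (i + j) ys)) = rotate (n + 1 - j + j) (merge j ?zs)"
          by (simp only: rotate_rotate)
        also have "\<dots> = merge j ?zs"
          using that l by (simp del: rotate_Suc)
        finally have "v j (i + j) = signed ((n + 1) * (i + j)) (F (merge j ?zs) 1)"
          by (simp only: v_def \<psi>_def)
        then show ?thesis by (simp add: signed_def)
      qed
      have "(\<Sum>j<n+1. signed (n * j) (v j (i + j))) =
         - signed ((n + 1) * i) (\<Sum>j<n+1. signed (j + 1) (F (merge j ?zs) 1))"
        unfolding signed_sum sum_negf[symmetric] by (intro sum.cong refl v2) simp
      then show ?thesis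
        unfolding dual_diff_eq[OF lz] u2 by (simp only: u_def signed_plus) (simp add: signed_def)
    qed
    have "connes_B (n + 1) (hochschild_diff (D scale) (n + 1) F) xs x0
        = (\<Sum>i<n+2. signed ((n + 1) * i) (hochschild_diff (D scale) (n + 1) F (rotate i ys) 1))"
      unfolding connes_B_eq[OF len] cyclic_sum_def ys_def[symmetric] ly
      by (intro sum.cong refl signed_cong) auto
    also have "\<dots> = (\<Sum>i<n+2. u i) - (\<Sum>i<n+2. u (i + (n + 1)))
        - (\<Sum>i<n+2. \<Sum>j<n+1. signed (n * j) (v j (i + j)))"
      by (simp only: summand sum_subtractf)
    also have "(\<Sum>i<n+2. u (i + (n + 1))) = (\<Sum>i<n+2. u i)"
      by (rule sum_periodic_shift) (simp only: u_def period signed_cong[OF parity])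
    also have "(\<Sum>i<n+2. \<Sum>j<n+1. signed (n * j) (v j (i + j))) =
        (\<Sum>j<n+1. signed (n * j) (\<Sum>i<n+2. v j (i + j)))"
      by (subst sum.swap) (simp only: signed_sum)
    also have "\<dots> = (\<Sum>j<n+1. signed (n * j) (\<Sum>k<n+2. v j k))"
      by (intro sum.cong refl arg_cong[where f="signed _"] sum_periodic_shift)
         (simp only: v_def period signed_cong[OF parity])
    also have "\<dots> = (\<Sum>k<n+2. \<Sum>j<n+1. signed (n * j) (v j k))"
      unfolding signed_sum by (rule sum.swap)
    also have "\<dots> = E"
      unfolding E_def
    proof (intro sum.cong refl)
      fix k
      have "length (merge 0 (rotate k ys)) = n + 1" using ly by (simp add: length_merge)
      moreover have "even ((n + 1 + 1) * j) = even (n * j)" for j by auto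
      ultimately have "cyclic_sum \<psi> (merge 0 (rotate k ys)) =
         (\<Sum>j<n+1. signed (n * j) (\<psi> (rotate (n + 1 - j) (merge 0 (rotate k ys)))))"
        using cyclic_sum_backwards[of "merge 0 (rotate k ys)" \<psi>] by (simp only: signed_def)
      then show "(\<Sum>j<n+1. signed (n * j) (v j k)) = signed ((n + 1) * k) (cyclic_sum \<psi> (merge 0 (rotate k ys)))"
        by (simp only: signed_sum v_def signed_add_left[symmetric] add.commute)
    qed
    finally show ?thesis by simp
  qed
  ultimately show ?thesis by simp
qed

section \<open>The isomorphism\<close>

lemma well_defined_transport:
  assumes "operations_well_defined H" "bv_isomorphism \<Phi> H K"
  shows "operations_well_defined K"
proof -
  have onto: "\<exists>x\<in>component H n. y = \<Phi> n x" if "y \<in> component K n" for n y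
    using assms(2) that unfolding bv_isomorphism_def bij_betw_def by blast
  have into: "\<Phi> n x \<in> component K n" if "x \<in> component H n" for n x
    using assms(2) that unfolding bv_isomorphism_def bij_betw_def by blast
  show ?thesis
    unfolding operations_well_defined_def
  proof (intro conjI allI ballI)
    fix n x y assume "x \<in> component K n" "y \<in> component K n"
    then obtain x' y' where "x' \<in> component H n" "x = \<Phi> n x'" "y' \<in> component H n" "y = \<Phi> n y'"
      using onto by metis
    then show "gadd K n x y \<in> component K n"
      using assms into[of "gadd H n x' y'" n] by (simp add: bv_isomorphism_def operations_well_defined_def)
  next
    fix n c x assume "x \<in> component K n"
    then obtain x' where "x' \<in> component H n" "x = \<Phi> n x'"
      using onto by metis
    then show "gscale K n c x \<in> component K n"
      using assms into[of "gscale H n c x'" n] by (simp add: bv_isomorphism_def operations_well_defined_def)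
  next
    fix n m x y assume "x \<in> component K n" "y \<in> component K m"
    then obtain x' y' where "x' \<in> component H n" "x = \<Phi> n x'" "y' \<in> component H m" "y = \<Phi> m y'"
      using onto by metis
    then show "product K n m x y \<in> component K (n + m)"
      using assms into[of "product H n m x' y'" "n + m"] by (simp add: bv_isomorphism_def operations_well_defined_def)
  next
    fix n m x y assume "x \<in> component K n" "y \<in> component K m"
    then obtain x' y' where "x' \<in> component H n" "x = \<Phi> n x'" "y' \<in> component H m" "y = \<Phi> m y'"
      using onto by metis
    then show "bracket K n m x y \<in> component K (n + m - 1)"
      using assms into[of "bracket H n m x' y'" "n + m - 1"] by (simp add: bv_isomorphism_def operations_well_defined_def)
  next
    fix n x assume "x \<in> component K (Suc n)"
    then obtain x' where "x' \<in> component H (Suc n)" "x = \<Phi> (Suc n) x'"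
      using onto by metis
    then show "bv_op K n x \<in> component K n"
      using assms into[of "bv_op H n x'" n] by (simp add: bv_isomorphism_def operations_well_defined_def)
  qed
qed

text \<open>
  The image of an induced operation is computed on representatives, once the map \<open>\<theta>\<close> carries classes onto classes.
\<close>

lemma image_induced1:
  assumes "\<And>u. S `` {\<theta> u} = \<theta> ` (R `` {u})"
    and "\<And>f. f \<in> X \<Longrightarrow> op' (\<theta> f) = \<theta> (op f)"
  shows "\<theta> ` induced1 R op X = induced1 S op' (\<theta> ` X)"
  using assms by (simp add: induced1_def image_UN)

lemma image_induced2:
  assumes "\<And>u. S `` {\<theta> u} = \<theta> ` (R `` {u})"
    and "\<And>f g. f \<in> X \<Longrightarrow> g \<in> Y \<Longrightarrow> op' (\<theta> f) (\<theta> g) = \<theta> (op f g)"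
  shows "\<theta> ` induced2 R op X Y = induced2 S op' (\<theta> ` X) (\<theta> ` Y)"
  using assms by (simp add: induced2_def image_UN)

context symmetric_algebra
begin

abbreviation klin :: "('a \<Rightarrow> 'k) \<Rightarrow> bool" where "klin \<equiv> Vector_Spaces.linear scale (*)"

lemma vector_space_mult: "vector_space ((*) :: 'k \<Rightarrow> 'k \<Rightarrow> 'k)"
  by unfold_locales (simp_all add: algebra_simps)

lemma klin_iff: "klin \<phi> \<longleftrightarrow> (\<forall>a b. \<phi> (a + b) = \<phi> a + \<phi> b) \<and> (\<forall>c a. \<phi> (scale c a) = c * \<phi> a)"
  by (simp add: Vector_Spaces.linear_iff vector_space_axioms vector_space_mult)

lemma dual_linear_iff:
  "Vector_Spaces.linear scale (mscale (D scale)) u \<longleftrightarrow> (\<forall>x. klin (\<lambda>a. u a x))"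
proof -
  have "vector_space (mscale (D scale))"
    by unfold_locales (auto simp: fun_eq_iff algebra_simps)
  then show ?thesis
    by (auto simp: Vector_Spaces.linear_iff klin_iff vector_space_axioms vector_space_mult fun_eq_iff)
qed

lemma form_klin_left: "klin (\<lambda>a. form a b)" and form_klin_right: "klin (form a)"
  using form_linear_left form_linear_right by auto

lemma form_add_left: "form (a + b) = form a + form b"
  and form_scale_left: "form (scale c a) x = c * form a x"
  using form_klin_left by (auto simp: klin_iff fun_eq_iff)

lemma form_zero_left: "form 0 = 0"
  using form_add_left[of 0 0] by simp

lemma form_minus_left: "form (- a) = - form a"
  using form_add_left[of a "- a"] form_zero_left by (simp add: eq_neg_iff_add_eq_0 add.commute)

lemma form_diff_left: "form (a - b) = form a - form b"
  using form_add_left[of a "- b"] form_minus_left by simp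

lemma form_sum_left: "form (sum u I) = (\<Sum>i\<in>I. form (u i))"
  by (induction I rule: infinite_finite_induct) (simp_all add: form_zero_left form_add_left)

lemma form_signed_left: "form (signed k a) = signed k (form a)"
  by (simp add: signed_def form_minus_left)

lemma form_commutator: "form (a * b - b * a) 1 = 0"
  using form_associative[of a b 1] form_associative[of b a 1] form_symmetric[of a b]
  by (simp add: form_diff_left)

lemma inj_form: "inj form"
proof (rule injI)
  fix a b assume "form a = form b"
  then have "form (a - b) c = 0" for c by (simp add: form_diff_left)
  then have "a - b = 0" by (rule form_nondegenerate)
  then show "a = b" by simp
qed

lemma Z_inv_form [simp]: "Z_inv form (form a) = a"
  by (simp add: Z_inv_def inj_form)

text \<open>
  For a basis \<open>B\<close> the endomorphism \<open>T a = (\<Sum>b\<in>B. \<langle>a, b\<rangle> b)\<close> of \<open>A\<close> is injective by non-degeneracy, hence surjective.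
  A vector that \<open>T\<close> maps to \<open>(\<Sum>b\<in>B. \<phi>(b) b)\<close> represents the functional \<open>\<phi>\<close>.
\<close>

lemma form_onto_dual:
  assumes "klin \<phi>"
  shows "\<exists>a. form a = \<phi>"
proof -
  obtain B0 where "finite B0" "span B0 = UNIV" using finite_dimensional by blast
  moreover obtain B where "B \<subseteq> B0" "independent B" "B0 \<subseteq> span B"
    by (rule maximal_independent_subset[of B0])
  ultimately have B: "finite B" "independent B" "span B = UNIV"
    using span_mono[of B0 "span B"] by (auto simp: finite_subset span_span)
  interpret fd: finite_dimensional_vector_space scale B
    by unfold_locales (use B in auto)
  define T where "T a = (\<Sum>b\<in>B. scale (form a b) b)" for a
  have unique: "\<phi> b = \<psi> b" if "(\<Sum>b\<in>B. scale (\<phi> b) b) = (\<Sum>b\<in>B. scale (\<psi> b) b)" "b \<in> B" for \<phi> \<psi> b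
  proof -
    have "(\<Sum>b\<in>B. scale (\<phi> b - \<psi> b) b) = 0"
      using that(1) by (simp add: scale_left_diff_distrib sum_subtractf)
    then have "\<phi> b - \<psi> b = 0"
      using independentD[OF B(2,1) subset_refl, of "\<lambda>b. \<phi> b - \<psi> b" b] that(2) by blast
    then show ?thesis by simp
  qed
  have ext: "\<phi> = \<psi>" if "klin \<phi>" "klin \<psi>" "\<And>b. b \<in> B \<Longrightarrow> \<phi> b = \<psi> b" for \<phi> \<psi>
  proof -
    interpret vp: vector_space_pair scale "(*) :: 'k \<Rightarrow> 'k \<Rightarrow> 'k"
      by (rule vector_space_pair.intro[OF vector_space_axioms vector_space_mult])
    show ?thesis using vp.linear_eq_on[OF that(1,2)] that(3) B(3) by blast
  qed
  have "Vector_Spaces.linear scale scale T"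
    by (simp add: lin_iff T_def form_add_left form_scale_left scale_left_distrib sum.distrib scale_sum_right)
  moreover have "inj T"
  proof (rule injI)
    fix a b assume "T a = T b"
    then have "form a c = form b c" if "c \<in> B" for c
      using unique[of "form a" "form b" c] that by (simp add: T_def)
    then have "form a = form b" by (rule ext[OF form_klin_right form_klin_right])
    then show "a = b" using inj_form by (simp add: inj_eq)
  qed
  ultimately have "surj T" by (rule fd.linear_inj_imp_surj)
  then obtain a where "T a = (\<Sum>b\<in>B. scale (\<phi> b) b)" by (metis surjD)
  then have "form a b = \<phi> b" if "b \<in> B" for b
    using unique[of "form a" \<phi> b] that by (simp add: T_def)
  then have "form a = \<phi>" by (rule ext[OF form_klin_right assms])
  then show ?thesis by blast
qed

definition Z_cochain :: "('a list \<Rightarrow> 'a) \<Rightarrow> 'a list \<Rightarrow> 'a \<Rightarrow> 'k" where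
  "Z_cochain f xs = form (f xs)"

abbreviation DC :: "nat \<Rightarrow> ('a list \<Rightarrow> 'a \<Rightarrow> 'k) set" where "DC \<equiv> cochains scale (D scale)"

lemma inj_Z_cochain: "inj Z_cochain"
  by (rule injI) (simp add: Z_cochain_def fun_eq_iff[where f="Z_cochain _"] inj_eq[OF inj_form] fun_eq_iff[where 'a="'a list"])

lemma dual_carrier: "\<phi> \<in> mcarrier (D scale) \<longleftrightarrow> klin \<phi>"
  by (simp add: dual_bimodule_def)

lemma Z_cochain_in_DC_iff: "Z_cochain f \<in> DC n \<longleftrightarrow> f \<in> C n"
proof -
  have lin: "(\<forall>x. klin (\<lambda>a. form (u a) x)) \<longleftrightarrow> lin u" for u
  proof
    assume *: "\<forall>x. klin (\<lambda>a. form (u a) x)"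
    show "lin u"
      unfolding lin_iff
    proof (intro conjI allI)
      fix a b
      have "form (u (a + b)) = form (u a + u b)"
        using * by (simp add: klin_iff fun_eq_iff form_add_left)
      then show "u (a + b) = u a + u b" using inj_form by (simp add: inj_eq)
    next
      fix c a
      have "form (u (scale c a)) = form (scale c (u a))"
        using * by (simp add: klin_iff fun_eq_iff form_scale_left)
      then show "u (scale c a) = scale c (u a)" using inj_form by (simp add: inj_eq)
    qed
  qed (simp add: lin_iff klin_iff form_add_left form_scale_left)
  have "form b = 0 \<longleftrightarrow> b = 0" for b
    using inj_eq[OF inj_form, of b 0] by (simp add: form_zero_left)
  then show ?thesis
    unfolding cochains_def dual_linear_iff Z_cochain_def
    by (simp add: lin dual_carrier form_klin_right)
qed

lemma Z_cochain_onto: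
  assumes "F \<in> DC n"
  shows "\<exists>f. F = Z_cochain f"
proof -
  have "\<exists>a. F xs = form a" for xs
  proof (cases "length xs = n")
    case True
    then show ?thesis
      using form_onto_dual[of "F xs"] cochains_carrier[OF assms True] by (metis dual_carrier)
  next
    case False
    then show ?thesis using cochains_length[OF assms False] form_zero_left by metis
  qed
  then obtain f where "\<And>xs. F xs = form (f xs)" by metis
  then show ?thesis by (intro exI[of _ f]) (simp add: fun_eq_iff Z_cochain_def)
qed

lemma DC_eq: "DC n = Z_cochain ` C n"
proof (intro subset_antisym subsetI)
  fix F assume "F \<in> DC n"
  then show "F \<in> Z_cochain ` C n" using Z_cochain_onto Z_cochain_in_DC_iff by blast
qed (auto simp: Z_cochain_in_DC_iff)

text \<open>
  Left multiplications match because the form is symmetric: \<open>\<langle>b, x a\<rangle> = \<langle>a b, x\<rangle>\<close>.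
\<close>

lemma lact_form: "lact (D scale) a (form b) = form (a * b)"
  using form_associative form_symmetric by (metis (no_types) ext dual_simps(2))

lemma ract_form: "ract (D scale) (form b) a = form (b * a)"
  using form_associative by (simp add: fun_eq_iff)

lemma mscale_sign_dual: "mscale (D scale) ((-1) ^ k) \<phi> = signed k \<phi>"
  by (cases "even k") (auto simp: signed_def fun_eq_iff)

lemma diff_Z_cochain: "hochschild_diff (D scale) n (Z_cochain f) = Z_cochain (\<delta> n f)"
  by (rule ext) (simp add: hochschild_diff_def Z_cochain_def lact_form ract_form mscale_sign_dual scale_sign
      form_add_left form_sum_left form_signed_left form_zero_left del: power_Suc)

lemma Z_cochain_eq_0_iff: "Z_cochain f = 0 \<longleftrightarrow> f = 0"
proof -
  have "Z_cochain 0 = 0" by (simp add: Z_cochain_def fun_eq_iff form_zero_left)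
  then show ?thesis using inj_eq[OF inj_Z_cochain, of f 0] by simp
qed

lemma Z_cochain_diff: "Z_cochain f - Z_cochain g = Z_cochain (f - g)"
  by (simp add: Z_cochain_def fun_eq_iff form_diff_left)

lemma dual_cocycles: "cocycles scale (D scale) n = Z_cochain ` cocyc n"
  unfolding cocycles_def DC_eq by (auto simp: diff_Z_cochain Z_cochain_eq_0_iff)

lemma dual_coboundaries: "coboundaries scale (D scale) n = Z_cochain ` cobd n"
  unfolding coboundaries_def DC_eq
  by (cases n) (auto simp: diff_Z_cochain image_image Z_cochain_eq_0_iff)

lemma Z_cochain_cohomologous_iff: "(Z_cochain f, Z_cochain g) \<in> cohomologous scale (D scale) n \<longleftrightarrow> (f, g) \<in> cohom n"
  unfolding cohomologous_def dual_cocycles dual_coboundaries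
  by (simp add: Z_cochain_diff inj_image_mem_iff[OF inj_Z_cochain])

lemma Z_cochain_class: "cohomologous scale (D scale) n `` {Z_cochain f} = Z_cochain ` (cohom n `` {f})"
proof (intro set_eqI iffI)
  fix G assume G: "G \<in> cohomologous scale (D scale) n `` {Z_cochain f}"
  then have "G \<in> Z_cochain ` cocyc n" by (auto simp: cohomologous_def dual_cocycles[symmetric])
  then show "G \<in> Z_cochain ` (cohom n `` {f})" using G Z_cochain_cohomologous_iff by auto
qed (use Z_cochain_cohomologous_iff in auto)

lemma dual_cohomology: "hochschild_cohomology scale (D scale) n = image Z_cochain ` hochschild_cohomology scale R n"
  unfolding hochschild_cohomology_def quotient_def dual_cocycles by (auto simp: Z_cochain_class)

lemma Z_cochain_cup: "cup (dual_mult form) n m (Z_cochain f) (Z_cochain g) = Z_cochain (cup (*) n m f g)"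
  by (simp add: cup_def Z_cochain_def dual_mult_def fun_eq_iff form_zero_left)

lemma Z_cochain_circ: "circ (D scale) n m (Z_cochain f) g = Z_cochain (circ R n m f g)"
  by (rule ext) (simp add: circ_def Z_cochain_def mscale_sign_dual scale_sign form_sum_left form_signed_left form_zero_left)

lemma Z_cochain_bracket: "dual_bracket scale form n m (Z_cochain f) (Z_cochain g) = Z_cochain (gerstenhaber_bracket scale n m f g)"
proof -
  have "Z_inv form \<circ> Z_cochain h = h" for h by (simp add: Z_cochain_def fun_eq_iff)
  then show ?thesis
    by (intro ext) (simp only: dual_bracket_def gerstenhaber_bracket_def Z_cochain_circ mscale_sign_dual scale_sign
      Z_cochain_def form_diff_left form_signed_left)
qed

lemma connes_B_in_DC:
  assumes F: "F \<in> DC (Suc n)"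
  shows "connes_B n F \<in> DC n"
proof -
  have klin: "klin (\<lambda>a. cyclic_sum (\<lambda>zs. F zs 1) (us @ [a] @ vs))" if "length us + length vs = n" for us vs
  proof -
    have rot: "klin (\<lambda>a. F (rotate i (us @ [a] @ vs)) 1)" for i
    proof -
      obtain us' vs' where len: "length us' + length vs' = length us + length vs"
        and eq: "\<And>a. rotate i (us @ [a] @ vs) = us' @ [a] @ vs'"
        using rotate_slot by metis
      have "length us' + length vs' + 1 = Suc n" using len that by simp
      from cochains_slotD[OF F this] show ?thesis
        unfolding eq dual_linear_iff by blast
    qed
    have l: "length (us @ [a] @ vs) = Suc n" for a using that by simp
    show ?thesis
      unfolding cyclic_sum_def l klin_iff
      using rot by (simp only: klin_iff signed_plus sum.distrib sum_distrib_left)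
        (auto simp: signed_def intro!: sum.cong)
  qed
  show ?thesis
  proof (rule cochains_slotI)
    fix xs :: "'a list" assume "length xs \<noteq> n"
    then show "connes_B n F xs = 0" by (simp add: connes_B_def)
  next
    fix xs :: "'a list" assume len: "length xs = n"
    show "connes_B n F xs \<in> mcarrier (D scale)"
      using klin[of "[]" xs] len by (simp add: dual_carrier connes_B_eq[OF len, symmetric])
  next
    fix us vs :: "'a list" assume len: "length us + length vs + 1 = n"
    have "klin (\<lambda>a. connes_B n F (us @ [a] @ vs) x)" for x
      using klin[of "x # us" vs] len connes_B_eq[of "us @ [_] @ vs" n F x] by simp
    then show "Vector_Spaces.linear scale (mscale (D scale)) (\<lambda>a. connes_B n F (us @ [a] @ vs))"
      unfolding dual_linear_iff by blast
  qed
qed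

text \<open>
  The two cyclic sums agree up to a shift by one step, which does not matter for a full period.  Moreover \<open>B\<close>
  takes values in the linear functionals, so that the element described in the definition of \<open>\<Delta>\<close> exists.
\<close>

lemma Z_cochain_delta:
  assumes f: "f \<in> C (Suc n)"
  shows "Z_cochain (tradler_delta form n f) = connes_B n (Z_cochain f)"
proof (rule ext)
  fix xs
  show "Z_cochain (tradler_delta form n f) xs = connes_B n (Z_cochain f) xs"
  proof (cases "length xs = n")
    case True
    let ?t = "\<lambda>a. \<Sum>i=1..n + 1. (-1) ^ (i * n) * form (f (rotate (i - 1) (xs @ [a]))) 1"
    have t: "?t a = connes_B n (Z_cochain f) xs a" for a
    proof -
      define u where "u i = signed (n * i) (form (f (rotate i (a # xs))) 1)" for i
      have "?t a = (\<Sum>i<n+1. u (i + 1))"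
      proof -
        have "rotate i (xs @ [a]) = rotate (Suc i) (a # xs)" for i
          by (simp only: rotate_Suc rotate1_rotate_swap rotate1.simps)
        then have "(\<Sum>i<n+1. (-1) ^ (Suc i * n) * form (f (rotate (Suc i - 1) (xs @ [a]))) 1)
            = (\<Sum>i<n+1. u (i + 1))"
          unfolding sign_mult_eq_signed u_def
          by (intro sum.cong refl) (simp add: mult.commute del: rotate_Suc)
        then show ?thesis
          using sum.atLeast1_atMost_eq[of "\<lambda>i. (-1) ^ (i * n) * form (f (rotate (i - 1) (xs @ [a]))) 1" "n + 1"]
          by (simp only: One_nat_def)
      qed
      also have "\<dots> = (\<Sum>i<n+1. u i)"
      proof (rule sum_periodic_shift)
        fix i
        have "even (n * (i + (n + 1))) = even (n * i)" by auto
        from signed_cong[OF this] show "u (i + (n + 1)) = u i"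
          using rotate_add_length[of i "a # xs"] True by (simp add: u_def)
      qed
      also have "\<dots> = connes_B n (Z_cochain f) xs a"
        using True by (simp add: connes_B_def atLeast0AtMost lessThan_Suc_atMost u_def sign_mult_eq_signed Z_cochain_def
             del: sum.lessThan_Suc)
      finally show ?thesis .
    qed
    have "klin (connes_B n (Z_cochain f) xs)"
      using cochains_carrier[OF connes_B_in_DC True] f by (simp add: Z_cochain_in_DC_iff dual_carrier)
    then obtain b where b: "form b = connes_B n (Z_cochain f) xs" using form_onto_dual by blast
    have "tradler_delta form n f xs = b"
      unfolding tradler_delta_def if_P[OF True] t b[symmetric]
      by (rule the_equality) (use inj_form in \<open>auto simp: fun_eq_iff[symmetric] inj_eq\<close>)
    then show ?thesis using b by (simp add: Z_cochain_def)
  qed (simp add: Z_cochain_def tradler_delta_def connes_B_def form_zero_left)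
qed

lemma delta_in_C: "f \<in> C (Suc n) \<Longrightarrow> tradler_delta form n f \<in> C n"
  using connes_B_in_DC Z_cochain_delta Z_cochain_in_DC_iff by metis

lemma diff_delta:
  assumes "f \<in> C (Suc n)"
  shows "connes_B (Suc n) (Z_cochain (\<delta> (Suc n) f)) = - Z_cochain (\<delta> n (tradler_delta form n f))"
proof (rule ext)
  fix xs
  show "connes_B (Suc n) (Z_cochain (\<delta> (Suc n) f)) xs = (- Z_cochain (\<delta> n (tradler_delta form n f))) xs"
  proof (cases "length xs = n + 1")
    case True
    show ?thesis
      using connes_B_anticommutes[OF True, of scale "Z_cochain f"]
      by (simp add: diff_Z_cochain[symmetric] Z_cochain_delta[OF assms] fun_eq_iff)
  next
    case False
    then show ?thesis
      by (simp add: connes_B_def diff_Z_cochain[symmetric] hochschild_diff_def)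
  qed
qed

text \<open>
  A coboundary \<open>\<delta>u\<close> with \<open>u\<close> of positive degree is mapped to the coboundary \<open>-\<delta>(\<Delta>u)\<close>.  For \<open>u\<close> of degree \<open>0\<close> the
  operator \<open>\<Delta>\<close> vanishes on \<open>\<delta>u\<close> because the form is zero on commutators paired with \<open>1\<close>.
\<close>

lemma delta_on_cohomology:
  assumes "X \<in> hochschild_cohomology scale R (Suc n)"
  shows "induced1 (cohom n) (tradler_delta form n) X \<in> hochschild_cohomology scale R n"
proof -
  have Bzero: "connes_B m (Z_cochain 0) = 0" for m
    by (simp add: connes_B_def Z_cochain_def form_zero_left fun_eq_iff)
  have closed: "tradler_delta form n f \<in> cocyc n" if "f \<in> cocyc (Suc n)" for f
  proof -
    have f: "f \<in> C (Suc n)" "\<delta> (Suc n) f = 0" using that by (auto simp: cocycles_def)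
    then have "\<delta> n (tradler_delta form n f) = 0"
      using diff_delta[OF f(1)] by (simp add: Bzero Z_cochain_eq_0_iff)
    then show ?thesis using delta_in_C[OF f(1)] by (simp add: cocycles_def)
  qed
  have cobd: "tradler_delta form n f \<in> cobd n" if f: "f \<in> cobd (Suc n)" "f \<in> C (Suc n)" for f
  proof -
    obtain u where u: "u \<in> C n" "f = \<delta> n u" using f(1) by (auto simp: cobd_Suc_iff)
    have eq: "Z_cochain (tradler_delta form n f) = connes_B n (Z_cochain (\<delta> n u))"
      using Z_cochain_delta[OF f(2)] u by simp
    show ?thesis
    proof (cases n)
      case 0
      have "connes_B n (Z_cochain (\<delta> n u)) = 0"
        by (auto simp: 0 fun_eq_iff connes_B_def Z_cochain_def \<delta>_eq signed_def form_zero_left form_commutator)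
      then have "tradler_delta form n f = 0" using eq by (simp only: Z_cochain_eq_0_iff)
      then show ?thesis by (simp add: 0 cobd_0_iff zero_fun_def)
    next
      case (Suc m)
      have "Z_cochain (tradler_delta form n f) = - Z_cochain (\<delta> m (tradler_delta form m u))"
        using eq diff_delta u(1) by (simp add: Suc)
      also have "\<dots> = Z_cochain (\<lambda>xs. signed 1 (\<delta> m (tradler_delta form m u) xs))"
        by (simp add: Z_cochain_def fun_eq_iff signed_def form_minus_left)
      finally have "tradler_delta form n f = (\<lambda>xs. signed 1 (\<delta> m (tradler_delta form m u) xs))"
        using inj_Z_cochain by (simp add: inj_eq)
      moreover have "\<delta> m (tradler_delta form m u) \<in> cobd n"
        using delta_in_C u(1) by (auto simp: Suc cobd_Suc_iff)
      ultimately show ?thesis by (simp only: signed_in_cobd)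
    qed
  qed
  have diff: "tradler_delta form n (\<lambda>xs. f xs - g xs) = (\<lambda>xs. tradler_delta form n f xs - tradler_delta form n g xs)"
    if "f \<in> C (Suc n)" "g \<in> C (Suc n)" for f g
  proof -
    have "Z_cochain (tradler_delta form n (\<lambda>xs. f xs - g xs)) = connes_B n (Z_cochain (\<lambda>xs. f xs - g xs))"
      by (rule Z_cochain_delta[OF diff_in_C[OF that]])
    also have "\<dots> = connes_B n (Z_cochain f) - connes_B n (Z_cochain g)"
      by (simp add: connes_B_def Z_cochain_def fun_eq_iff form_diff_left right_diff_distrib sum_subtractf)
    also have "\<dots> = Z_cochain (\<lambda>xs. tradler_delta form n f xs - tradler_delta form n g xs)"
      unfolding Z_cochain_delta[OF that(1), symmetric] Z_cochain_delta[OF that(2), symmetric] Z_cochain_diff by (simp add: fun_diff_def)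
    finally show ?thesis using inj_Z_cochain by (simp add: inj_eq)
  qed
  show ?thesis
    unfolding hochschild_cohomology_def
  proof (rule quotient_induced1[OF equiv_cohom equiv_cohom closed])
    fix f g assume fg: "(f, g) \<in> cohom (Suc n)"
    then have "f \<in> C (Suc n)" "g \<in> C (Suc n)" by (auto simp: cohom_iff cocyc_iff)
    then show "(tradler_delta form n f, tradler_delta form n g) \<in> cohom n"
      using fg closed cobd[of "\<lambda>xs. f xs - g xs"] diff by (simp add: cohom_iff diff_in_C)
  qed (use assms in \<open>auto simp: hochschild_cohomology_def\<close>)
qed

lemma HH_well_defined: "operations_well_defined (HH_bv scale form)"
  unfolding operations_well_defined_def HH_bv_def cohomology_bv_structure_def gerstenhaber_bracket_eq
  using add_on_cohomology scale_on_cohomology cup_on_cohomology bracket_on_cohomology delta_on_cohomology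
  by simp

lemma in_class_in_C: "X \<in> hochschild_cohomology scale R n \<Longrightarrow> f \<in> X \<Longrightarrow> f \<in> C n"
  by (auto simp: hochschild_cohomology_def quotient_def cohom_iff cocyc_iff)

lemma Z_cochain_bv_isomorphism: "bv_isomorphism (\<lambda>_. image Z_cochain) (HH_bv scale form) (H_dual_bv scale form)"
  unfolding bv_isomorphism_def HH_bv_def H_dual_bv_def cohomology_bv_structure_def
proof (simp, intro conjI allI ballI)
  fix n
  show "bij_betw (image Z_cochain) (hochschild_cohomology scale R n) (hochschild_cohomology scale (D scale) n)"
    unfolding bij_betw_def dual_cohomology
    using inj_Z_cochain by (auto simp: inj_on_def inj_image_eq_iff)
next
  fix n X Y
  show "Z_cochain ` induced2 (cohom n) (+) X Y = induced2 (cohomologous scale (D scale) n) (+) (Z_cochain ` X) (Z_cochain ` Y)"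
    by (rule image_induced2[OF Z_cochain_class]) (simp add: Z_cochain_def fun_eq_iff form_add_left)
next
  fix n c X
  show "Z_cochain ` induced1 (cohom n) (\<lambda>f xs. scale c (f xs)) X =
    induced1 (cohomologous scale (D scale) n) (\<lambda>f xs. mscale (D scale) c (f xs)) (Z_cochain ` X)"
    by (rule image_induced1[OF Z_cochain_class]) (simp add: Z_cochain_def fun_eq_iff form_scale_left)
next
  fix n m X Y
  show "Z_cochain ` induced2 (cohom (n + m)) (cup (*) n m) X Y =
    induced2 (cohomologous scale (D scale) (n + m)) (cup (dual_mult form) n m) (Z_cochain ` X) (Z_cochain ` Y)"
    by (rule image_induced2, rule Z_cochain_class, rule Z_cochain_cup)
next
  fix n m X Y
  show "Z_cochain ` induced2 (cohom (n + m - Suc 0)) (gerstenhaber_bracket scale n m) X Y =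
    induced2 (cohomologous scale (D scale) (n + m - Suc 0)) (dual_bracket scale form n m) (Z_cochain ` X) (Z_cochain ` Y)"
    by (rule image_induced2, rule Z_cochain_class, rule Z_cochain_bracket)
next
  fix n X assume X: "X \<in> hochschild_cohomology scale R (Suc n)"
  show "Z_cochain ` induced1 (cohom n) (tradler_delta form n) X =
    induced1 (cohomologous scale (D scale) n) (connes_B n) (Z_cochain ` X)"
    by (rule image_induced1[OF Z_cochain_class]) (simp add: Z_cochain_delta in_class_in_C[OF X])
qed

end

theorem corollary4p1:
  fixes scale :: "'k::field \<Rightarrow> 'a::{ring,monoid_mult} \<Rightarrow> 'a"
    and form :: "'a \<Rightarrow> 'a \<Rightarrow> 'k"
  assumes "symmetric_algebra scale form"
  shows "operations_well_defined (HH_bv scale form) \<and>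
         operations_well_defined (H_dual_bv scale form) \<and>
         bv_isomorphic (HH_bv scale form) (H_dual_bv scale form)"
proof -
  interpret symmetric_algebra scale form by fact
  show ?thesis
    using HH_well_defined Z_cochain_bv_isomorphism well_defined_transport
    unfolding bv_isomorphic_def by blast
qed

end
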